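(* There is a computable linear ordering $\mathcal{L}=(\mathbb{N},<_\mathcal{L})$ of order type $\omega+\omega^*$ such that the Lebesgue measure of the class of oracles $X\in 2^{\mathbb{N}}$ which compute an infinite set $\mathcal{L}$-avoiding some transitive pattern is $0$.
   Context: A pattern of size $\ell$ is a function $p:[\ell]^2\to2$ ($[\ell]^2$ the pairs $i<j<\ell$). A linear order $\mathcal{L}=(\mathbb{N},<_\mathcal{L})$ is identified with the coloring $f:[\mathbb{N}]^2\to2$ with $f(x,y)=0$ if $x<_\mathcal{L}y$ and $1$ otherwise ($x<y$). A finite set $\{x_0<\dots<x_{\ell-1}\}$ $\mathcal{L}$-realizes $p$ if $f(x_i,x_j)=p(i,j)$ for all $i<j$; a set $H$ $\mathcal{L}$-avoids $p$ if no subset of $H$ $\mathcal{L}$-realizes $p$. A pattern is transitive if it contains neither of the two non-transitivity patterns of size 3, namely the patterns $q_c$ ($c<2$) with $q_c(0,1)=q_c(1,2)=c$ and $q_c(0,2)=1-c$ (where $p$ contains $q$ if the restriction of $p$ to some set of indices, reindexed increasingly, equals $q$); equivalently, it is the pattern of a permutation. *)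

theory Defs
  imports "HOL-Probability.Probability"
begin

text \<open>Throughout, \<open>2 = {0, 1}\<close> is \<open>bool\<close>, with \<open>False\<close> for \<open>0\<close> and \<open>True\<close> for \<open>1\<close>;
  in particular an oracle in Cantor space is a function of type \<open>nat \<Rightarrow> bool\<close>.\<close>

section \<open>Relative computability\<close>

text \<open>Programs for the partial \<open>\<mu>\<close>-recursive functions relative to an oracle. Arities are not
  recorded in the syntax; a program applied to a list of the wrong length may have no value.\<close>

datatype prog =
    Zero
  | Succ
  | Proj nat
  | Query
  | Comp prog "prog list"
  | PrimRec prog prog
  | Mu prog

text \<open>\<open>evaluates X e xs y\<close>: program \<open>e\<close> with oracle \<open>X\<close> halts on input \<open>xs\<close> with output \<open>y\<close>.\<close>

inductive evaluates :: "(nat \<Rightarrow> bool) \<Rightarrow> prog \<Rightarrow> nat list \<Rightarrow> nat \<Rightarrow> bool"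
  for X :: "nat \<Rightarrow> bool" where
  zero: "evaluates X Zero xs 0"
| succ: "evaluates X Succ [x] (Suc x)"
| proj: "i < length xs \<Longrightarrow> evaluates X (Proj i) xs (xs ! i)"
| query: "evaluates X Query [x] (of_bool (X x))"
| comp: "\<lbrakk>list_all2 (\<lambda>g y. evaluates X g xs y) gs ys; evaluates X f ys z\<rbrakk>
    \<Longrightarrow> evaluates X (Comp f gs) xs z"
| primrec_0: "evaluates X f xs y \<Longrightarrow> evaluates X (PrimRec f g) (0 # xs) y"
| primrec_Suc: "\<lbrakk>evaluates X (PrimRec f g) (n # xs) r; evaluates X g (n # r # xs) y\<rbrakk>
    \<Longrightarrow> evaluates X (PrimRec f g) (Suc n # xs) y"
| mu: "\<lbrakk>evaluates X f (n # xs) 0; \<forall>m<n. \<exists>k>0. evaluates X f (m # xs) k\<rbrakk>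
    \<Longrightarrow> evaluates X (Mu f) xs n"

definition computes_set :: "(nat \<Rightarrow> bool) \<Rightarrow> nat set \<Rightarrow> bool" where
  "computes_set X H \<longleftrightarrow> (\<exists>e. \<forall>n. evaluates X e [n] (of_bool (n \<in> H)))"

text \<open>Computable without qualification means computable relative to the empty oracle.\<close>

definition computable_rel :: "(nat \<times> nat) set \<Rightarrow> bool" where
  "computable_rel R \<longleftrightarrow>
     (\<exists>e. \<forall>x y. evaluates (\<lambda>_. False) e [x, y] (of_bool ((x, y) \<in> R)))"


section \<open>Order types\<close>

text \<open>Linear orders are given by their strict relations, as in \<^const>\<open>strict_linear_order_on\<close>.\<close>

definition order_sum :: "('a \<times> 'a) set \<Rightarrow> ('b \<times> 'b) set \<Rightarrow> (('a + 'b) \<times> ('a + 'b)) set" where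
  "order_sum r s =
     {(Inl a, Inl a') | a a'. (a, a') \<in> r} \<union>
     {(Inr b, Inr b') | b b'. (b, b') \<in> s} \<union>
     {(Inl a, Inr b) | a b. True}"

definition order_isomorphic :: "('a \<times> 'a) set \<Rightarrow> ('b \<times> 'b) set \<Rightarrow> bool" where
  "order_isomorphic r s \<longleftrightarrow> (\<exists>h. bij h \<and> (\<forall>x y. (x, y) \<in> r \<longleftrightarrow> (h x, h y) \<in> s))"

definition omega_plus_omega_star :: "((nat + nat) \<times> (nat + nat)) set" where
  "omega_plus_omega_star = order_sum less_than (less_than\<inverse>)"


section \<open>Patterns\<close>

text \<open>A pattern of size \<open>l\<close> is a function \<open>p\<close> of which only the values \<open>p i j\<close> with
  \<open>i < j < l\<close> are relevant; the size is passed alongside \<open>p\<close>.\<close>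

type_synonym pattern = "nat \<Rightarrow> nat \<Rightarrow> bool"

definition contains_pattern :: "nat \<Rightarrow> pattern \<Rightarrow> nat \<Rightarrow> pattern \<Rightarrow> bool" where
  "contains_pattern l p m q \<longleftrightarrow>
     (\<exists>g. strict_mono_on {..<m} g \<and> g ` {..<m} \<subseteq> {..<l} \<and>
          (\<forall>i j. i < j \<and> j < m \<longrightarrow> p (g i) (g j) = q i j))"

definition nontransitive3 :: "bool \<Rightarrow> pattern" where
  "nontransitive3 c i j = (if i = 0 \<and> j = 2 then \<not> c else c)"

definition transitive_pattern :: "nat \<Rightarrow> pattern \<Rightarrow> bool" where
  "transitive_pattern l p \<longleftrightarrow> (\<forall>c. \<not> contains_pattern l p 3 (nontransitive3 c))"

definition order_coloring :: "(nat \<times> nat) set \<Rightarrow> nat \<Rightarrow> nat \<Rightarrow> bool" where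
  "order_coloring L x y = (if (x, y) \<in> L then False else True)"

text \<open>The increasing enumeration of \<open>F\<close> is with respect to the usual order of \<open>nat\<close>, not \<open>L\<close>.\<close>

definition realizes :: "(nat \<times> nat) set \<Rightarrow> nat \<Rightarrow> pattern \<Rightarrow> nat set \<Rightarrow> bool" where
  "realizes L l p F \<longleftrightarrow> finite F \<and> card F = l \<and>
     (\<forall>i j. i < j \<and> j < l \<longrightarrow>
        order_coloring L (sorted_list_of_set F ! i) (sorted_list_of_set F ! j) = p i j)"

definition avoids :: "(nat \<times> nat) set \<Rightarrow> nat \<Rightarrow> pattern \<Rightarrow> nat set \<Rightarrow> bool" where
  "avoids L l p H \<longleftrightarrow> (\<forall>F\<subseteq>H. \<not> realizes L l p F)"


section \<open>Lebesgue measure on Cantor space\<close>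

definition cantor_measure :: "(nat \<Rightarrow> bool) measure" where
  "cantor_measure = completion (PiM UNIV (\<lambda>_. measure_pmf (bernoulli_pmf (1 / 2))))"

end

theory Submission
  imports Defs "HOL-Library.Nat_Bijection" "HOL-Library.Fun_Lexorder"
begin

text \<open>Fix a program with code \<open>c\<close> and let \<open>g\<close> be the measure of the oracles \<open>X\<close> from which it
  enumerates arbitrarily large elements. For every rational \<open>q < g\<close> and every \<open>a\<close>, a search finds
  some \<open>b\<close> such that at least a fraction \<open>q\<close> of all oracles produce an element of \<open>[a, b)\<close>. As
  \<open>q\<close> tends to \<open>g\<close> and \<open>a\<close> to infinity, these are almost all the oracles that compute an
  infinite set through the program. So it suffices to build a computable \<open>L\<close> such that, for every
  such \<open>c\<close>, \<open>q\<close> and every permutation of size \<open>l\<close>, arbitrarily late intervals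
  \<open>[a\<^sub>0, b\<^sub>0), \<dots>, [a\<^sub>l\<^sub>-\<^sub>1, b\<^sub>l\<^sub>-\<^sub>1)\<close> obtained from this search are ordered by \<open>L\<close> blockwise as the
  permutation prescribes: a set that meets all of them realizes the pattern.

  This is a finite injury construction. Each requirement passes through finitely many blocks, and
  whenever it passes to the next one, all requirements of lower priority start again. The position
  of a number in \<open>L\<close> is the sequence of the values that the permutations give to the blocks in
  which it lies, and \<open>L\<close> compares these sequences lexicographically. As they converge, every
  number is eventually below all later numbers or above all of them.\<close>

section \<open>Closure properties of computable functions\<close>

text \<open>Functions of an environment \<open>v\<close> that are computable from finitely many of its values. Under
  a binder the bound variable becomes variable \<open>0\<close> and the others are shifted by one.\<close>

definition recfn :: "((nat \<Rightarrow> nat) \<Rightarrow> nat) \<Rightarrow> bool" where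
  "recfn F \<longleftrightarrow> (\<exists>n e. \<forall>v. evaluates (\<lambda>_. False) e (map v [0..<n]) (F v))"

lemma evaluates_Projs:
  assumes "n \<le> N"
  shows "list_all2 (\<lambda>g y. evaluates X g (map v [0..<N]) y) (map Proj [0..<n]) (map v [0..<n])"
proof -
  have "evaluates X (Proj i) (map v [0..<N]) (v i)" if "i < n" for i
    using evaluates.proj[of i "map v [0..<N]" X] that assms by simp
  then show ?thesis
    by (simp add: list_all2_conv_all_nth)
qed

text \<open>Projections discard surplus inputs, so programs for different functions can be given one
  common arity before they are composed.\<close>

lemma recfn_arity:
  assumes "recfn F"
  shows "\<exists>n. \<forall>N\<ge>n. \<exists>e. \<forall>v. evaluates (\<lambda>_. False) e (map v [0..<N]) (F v)"
proof -
  obtain n e where e: "\<And>v. evaluates (\<lambda>_. False) e (map v [0..<n]) (F v)"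
    using assms unfolding recfn_def by blast
  have "evaluates (\<lambda>_. False) (Comp e (map Proj [0..<n])) (map v [0..<N]) (F v)"
    if "N \<ge> n" for N v
    using evaluates.comp[OF evaluates_Projs[OF that] e] .
  then show ?thesis by blast
qed

lemma recfn_subst:
  assumes F: "recfn F" and g: "\<And>i. recfn (g i)"
  shows "recfn (\<lambda>v. F (\<lambda>i. g i v))"
proof -
  obtain n e where e: "\<And>v. evaluates (\<lambda>_. False) e (map v [0..<n]) (F v)"
    using F unfolding recfn_def by blast
  obtain m where m: "\<And>i N. N \<ge> m i \<Longrightarrow>
      \<exists>c. \<forall>v. evaluates (\<lambda>_. False) c (map v [0..<N]) (g i v)"
    using recfn_arity[OF g] by metis
  \<comment> \<open>The program \<open>e\<close> reads only the first \<open>n\<close> variables, so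
    a common arity for finitely many \<open>g i\<close> suffices although the family is
    infinite.\<close>
  define N where "N = (\<Sum>i<n. m i)"
  have "m i \<le> N" if "i < n" for i
    unfolding N_def using that by (intro member_le_sum) auto
  then have "\<forall>i. \<exists>c. i < n \<longrightarrow> (\<forall>v. evaluates (\<lambda>_. False) c (map v [0..<N]) (g i v))"
    using m by blast
  then obtain c where c: "\<And>i v. i < n \<Longrightarrow> evaluates (\<lambda>_. False) (c i) (map v [0..<N]) (g i v)"
    by metis
  have "list_all2 (\<lambda>h y. evaluates (\<lambda>_. False) h (map v [0..<N]) y)
      (map c [0..<n]) (map (\<lambda>i. g i v) [0..<n])" for v
    by (simp add: list_all2_conv_all_nth c)
  from evaluates.comp[OF this e] show ?thesis
    unfolding recfn_def by blast
qed

lemma recfn_var: "recfn (\<lambda>v. v i)"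
proof -
  have "evaluates (\<lambda>_. False) (Proj i) (map v [0..<Suc i]) (v i)" for v
    using evaluates.proj[of i "map v [0..<Suc i]" "\<lambda>_. False"]
    by (simp del: upt_Suc)
  then show ?thesis unfolding recfn_def by blast
qed

lemma recfn_comp1: "recfn (\<lambda>v. h (v 0)) \<Longrightarrow> recfn f \<Longrightarrow> recfn (\<lambda>v. h (f v))"
  using recfn_subst[of "\<lambda>v. h (v 0)" "\<lambda>_. f"] by simp

lemma recfn_comp2:
  assumes "recfn (\<lambda>v. h (v 0) (v (Suc 0)))" "recfn f" "recfn g"
  shows "recfn (\<lambda>v. h (f v) (g v))"
  using recfn_subst[OF assms(1), of "\<lambda>i. if i = 0 then f else g"] assms(2,3) by simp

lemma recfn_comp3:
  assumes "recfn (\<lambda>v. h (v 0) (v (Suc 0)) (v (Suc (Suc 0))))" "recfn f" "recfn g" "recfn k"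
  shows "recfn (\<lambda>v. h (f v) (g v) (k v))"
  using recfn_subst[OF assms(1), of "\<lambda>i. if i = 0 then f else if i = 1 then g else k"] assms(2-)
  by simp

lemma recfn_Suc: "recfn f \<Longrightarrow> recfn (\<lambda>v. Suc (f v))"
proof (rule recfn_comp1[of Suc])
  have "evaluates (\<lambda>_. False) Succ (map v [0..<1]) (Suc (v 0))" for v
    using evaluates.succ by simp
  then show "recfn (\<lambda>v. Suc (v 0))" unfolding recfn_def by blast
qed

lemma recfn_const: "recfn (\<lambda>v. c)"
proof (induction c)
  case 0
  show ?case unfolding recfn_def using evaluates.zero by blast
next
  case (Suc c)
  then show ?case by (rule recfn_Suc)
qed

text \<open>In the step function variable 0 is the counter, variable 1 the value so far, and the
  environment follows: the argument order of \<open>PrimRec\<close>.\<close>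

lemma recfn_rec:
  assumes f: "recfn f" and g: "recfn (\<lambda>w. g (w 0) (w (Suc 0)) (\<lambda>i. w (Suc (Suc i))))"
    and h: "recfn h"
  shows "recfn (\<lambda>v. rec_nat (f v) (\<lambda>k r. g k r v) (h v))"
proof -
  obtain nf where nf: "\<And>N. N \<ge> nf \<Longrightarrow> \<exists>c. \<forall>v. evaluates (\<lambda>_. False) c (map v [0..<N]) (f v)"
    using recfn_arity[OF f] by blast
  obtain ng where ng: "\<And>N. N \<ge> ng \<Longrightarrow> \<exists>c. \<forall>w. evaluates (\<lambda>_. False) c (map w [0..<N])
      (g (w 0) (w (Suc 0)) (\<lambda>i. w (Suc (Suc i))))"
    using recfn_arity[OF g] by blast
  obtain nh where nh: "\<And>N. N \<ge> nh \<Longrightarrow> \<exists>c. \<forall>v. evaluates (\<lambda>_. False) c (map v [0..<N]) (h v)"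
    using recfn_arity[OF h] by blast
  define N where "N = nf + ng + nh"
  obtain ef where ef: "\<And>v. evaluates (\<lambda>_. False) ef (map v [0..<N]) (f v)"
    using nf[of N] by (auto simp: N_def)
  obtain eh where eh: "\<And>v. evaluates (\<lambda>_. False) eh (map v [0..<N]) (h v)"
    using nh[of N] by (auto simp: N_def)
  obtain eg where eg: "\<And>w. evaluates (\<lambda>_. False) eg (map w [0..<N + 2])
      (g (w 0) (w (Suc 0)) (\<lambda>i. w (Suc (Suc i))))"
    using ng[of "N + 2"] by (auto simp: N_def)
  have eg': "evaluates (\<lambda>_. False) eg (k # r # map v [0..<N]) (g k r v)" for k r v
  proof -
    have "map (case_nat k (case_nat r v)) [0..<N + 2] = k # r # map v [0..<N]"
      by (simp add: upt_conv_Cons map_Suc_upt[symmetric] comp_def del: upt_Suc)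
    then show ?thesis using eg[of "case_nat k (case_nat r v)"] by simp
  qed
  have rec: "evaluates (\<lambda>_. False) (PrimRec ef eg) (n # map v [0..<N])
      (rec_nat (f v) (\<lambda>k r. g k r v) n)" for n v
    by (induction n) (auto intro: evaluates.primrec_0 evaluates.primrec_Suc ef eg')
  have "evaluates (\<lambda>_. False) (Comp (PrimRec ef eg) (eh # map Proj [0..<N])) (map v [0..<N])
      (rec_nat (f v) (\<lambda>k r. g k r v) (h v))" for v
    by (rule evaluates.comp[OF _ rec]) (use eh evaluates_Projs[of N N] in auto)
  then show ?thesis unfolding recfn_def by blast
qed

lemma recfn_add: "recfn f \<Longrightarrow> recfn g \<Longrightarrow> recfn (\<lambda>v. f v + g v)"
proof -
  assume "recfn f" "recfn g"
  moreover have "m + n = rec_nat m (\<lambda>k r. Suc r) n" for m n :: nat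
    by (induction n) auto
  ultimately show ?thesis
    by (simp only:) (intro recfn_rec recfn_Suc recfn_var)
qed

lemma recfn_mult: "recfn f \<Longrightarrow> recfn g \<Longrightarrow> recfn (\<lambda>v. f v * g v)"
proof (rule recfn_comp2[of "(*)"])
  have eq: "m * n = rec_nat 0 (\<lambda>k r. r + m) n" for m n :: nat
    by (induction n) auto
  show "recfn (\<lambda>v. v 0 * v (Suc 0))"
    unfolding eq by (intro recfn_rec recfn_add recfn_var recfn_const)
qed

lemma recfn_power: "recfn f \<Longrightarrow> recfn g \<Longrightarrow> recfn (\<lambda>v. f v ^ g v)"
proof (rule recfn_comp2[of "(^)"])
  have eq: "m ^ n = rec_nat 1 (\<lambda>k r. r * m) n" for m n :: nat
    by (induction n) auto
  show "recfn (\<lambda>v. v 0 ^ v (Suc 0))"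
    unfolding eq by (intro recfn_rec recfn_mult recfn_var recfn_const)
qed

lemma recfn_diff: "recfn f \<Longrightarrow> recfn g \<Longrightarrow> recfn (\<lambda>v. f v - g v)"
proof (rule recfn_comp2[of "(-)"])
  have pred: "n - 1 = rec_nat 0 (\<lambda>k r. k) n" for n :: nat
    by (cases n) auto
  have eq: "m - n = rec_nat m (\<lambda>k r. rec_nat 0 (\<lambda>k r. k) r) n" for m n :: nat
  proof (induction n)
    case (Suc n)
    have "m - Suc n = (m - n) - 1" by simp
    also have "\<dots> = rec_nat 0 (\<lambda>k r. k) (m - n)" by (rule pred)
    finally show ?case using Suc by simp
  qed auto
  show "recfn (\<lambda>v. v 0 - v (Suc 0))"
    unfolding eq by (intro recfn_rec recfn_var recfn_const)
qed

lemma recfn_sum: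
  assumes "recfn (\<lambda>w. g (w 0) (\<lambda>i. w (Suc i)))" "recfn f"
  shows "recfn (\<lambda>v. \<Sum>k<f v. g k v)"
proof -
  have eq: "(\<Sum>k<n. g k v) = rec_nat 0 (\<lambda>k r. r + g k v) n" for n v
    by (induction n) auto
  \<comment> \<open>The step function of \<open>recfn_rec\<close> has the accumulated value as
    variable 1, so all variables of \<open>g\<close> after the first move up by one.\<close>
  have "recfn (\<lambda>w. g (w 0) (\<lambda>i. w (Suc (Suc i))))"
    using recfn_subst[OF assms(1), of "\<lambda>i w. w (if i = 0 then 0 else Suc i)"]
    by (simp add: recfn_var)
  then show ?thesis unfolding eq
    by (intro recfn_rec recfn_var recfn_const assms recfn_add)
qed

section \<open>Decidable predicates and bounded search\<close>

definition decidable :: "((nat \<Rightarrow> nat) \<Rightarrow> bool) \<Rightarrow> bool" where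
  "decidable P \<longleftrightarrow> recfn (\<lambda>v. of_bool (P v))"

lemma recfn_of_bool: "decidable P \<Longrightarrow> recfn (\<lambda>v. of_bool (P v))"
  by (simp add: decidable_def)

lemma decidable_not: "decidable P \<Longrightarrow> decidable (\<lambda>v. \<not> P v)"
proof -
  have eq: "of_bool (\<not> b) = 1 - (of_bool b :: nat)" for b by auto
  show "decidable P \<Longrightarrow> ?thesis"
    unfolding decidable_def eq by (intro recfn_diff recfn_const)
qed

lemma decidable_conj: "decidable P \<Longrightarrow> decidable Q \<Longrightarrow> decidable (\<lambda>v. P v \<and> Q v)"
  unfolding decidable_def of_bool_conj by (rule recfn_mult)

lemma decidable_disj: "decidable P \<Longrightarrow> decidable Q \<Longrightarrow> decidable (\<lambda>v. P v \<or> Q v)"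
proof -
  have eq: "(\<lambda>v. P v \<or> Q v) = (\<lambda>v. \<not> (\<not> P v \<and> \<not> Q v))" by blast
  show "decidable P \<Longrightarrow> decidable Q \<Longrightarrow> ?thesis"
    unfolding eq by (intro decidable_not decidable_conj)
qed

lemma decidable_imp: "decidable P \<Longrightarrow> decidable Q \<Longrightarrow> decidable (\<lambda>v. P v \<longrightarrow> Q v)"
  unfolding imp_conv_disj by (intro decidable_not decidable_disj)

lemma decidable_iff: "decidable P \<Longrightarrow> decidable Q \<Longrightarrow> decidable (\<lambda>v. P v \<longleftrightarrow> Q v)"
  unfolding iff_conv_conj_imp by (intro decidable_conj decidable_imp)

lemma decidable_le: "recfn f \<Longrightarrow> recfn g \<Longrightarrow> decidable (\<lambda>v. f v \<le> g v)"
proof -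
  have eq: "of_bool (m \<le> n) = 1 - (m - n :: nat)" for m n by auto
  show "recfn f \<Longrightarrow> recfn g \<Longrightarrow> ?thesis"
    unfolding decidable_def eq by (intro recfn_diff recfn_const)
qed

lemma decidable_less: "recfn f \<Longrightarrow> recfn g \<Longrightarrow> decidable (\<lambda>v. f v < g v)"
  using decidable_le[OF recfn_Suc, of f g] by (simp add: Suc_le_eq)

lemma decidable_eq: "recfn f \<Longrightarrow> recfn g \<Longrightarrow> decidable (\<lambda>v. f v = g v)"
  using decidable_conj[OF decidable_le decidable_le, of f g g f] by (simp add: order_eq_iff)

lemma decidable_Ex:
  assumes "decidable (\<lambda>w. P (w 0) (\<lambda>i. w (Suc i)))" "recfn f"
  shows "decidable (\<lambda>v. \<exists>k<f v. P k v)"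
proof -
  have eq: "(\<exists>k<n. P k v) \<longleftrightarrow> 0 < (\<Sum>k<n. of_bool (P k v) :: nat)" for n v
    by (induction n) (auto simp: less_Suc_eq)
  show ?thesis
    unfolding eq using assms
    by (intro decidable_less recfn_const recfn_sum) (auto simp: decidable_def)
qed

lemma decidable_All:
  assumes "decidable (\<lambda>w. P (w 0) (\<lambda>i. w (Suc i)))" "recfn f"
  shows "decidable (\<lambda>v. \<forall>k<f v. P k v)"
  using decidable_not[OF decidable_Ex[OF decidable_not, of P f]] assms by simp

lemma recfn_if:
  assumes "decidable P" "recfn f" "recfn g"
  shows "recfn (\<lambda>v. if P v then f v else g v)"
proof -
  have eq: "(if b then m else n) = of_bool b * m + of_bool (\<not> b) * n" for b and m n :: nat
    by simp
  show ?thesis unfolding eq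
    using assms by (intro recfn_add recfn_mult recfn_of_bool decidable_not)
qed

text \<open>Bounded search for a unique witness: in the sum over all candidates only the term of the
  witness can be nonzero. This yields inverses of coding functions and quotients.\<close>

lemma recfn_unique:
  assumes "recfn b" "decidable (\<lambda>w. P (w 0) (\<lambda>i. w (Suc i)))"
    and "\<And>v. f v < b v" "\<And>v k. k < b v \<Longrightarrow> P k v \<longleftrightarrow> k = f v"
  shows "recfn f"
proof -
  have "f v = (\<Sum>k<b v. if P k v then k else 0)" for v
  proof -
    have "(\<Sum>k<b v. if P k v then k else 0) = (\<Sum>k<b v. if k = f v then k else 0)"
      using assms(4) by (intro sum.cong) auto
    then show ?thesis using assms(3)[of v] by simp
  qed
  then have "f = (\<lambda>v. \<Sum>k<b v. if P k v then k else 0)" by blast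
  moreover have "recfn (\<lambda>v. \<Sum>k<b v. if P k v then k else 0)"
    by (intro recfn_sum recfn_if assms recfn_var recfn_const)
  ultimately show ?thesis by simp
qed

lemma decidable_subst1: "decidable (\<lambda>v. P (v 0)) \<Longrightarrow> recfn f \<Longrightarrow> decidable (\<lambda>v. P (f v))"
  unfolding decidable_def by (rule recfn_comp1[of "\<lambda>x. of_bool (P x)"])

lemma decidable_subst2:
  "decidable (\<lambda>v. P (v 0) (v (Suc 0))) \<Longrightarrow> recfn f \<Longrightarrow> recfn g \<Longrightarrow> decidable (\<lambda>v. P (f v) (g v))"
  unfolding decidable_def by (rule recfn_comp2[of "\<lambda>x y. of_bool (P x y)"])

lemma decidable_subst3:
  "decidable (\<lambda>v. P (v 0) (v (Suc 0)) (v (Suc (Suc 0)))) \<Longrightarrow> recfn f \<Longrightarrow> recfn g \<Longrightarrow> recfn h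
    \<Longrightarrow> decidable (\<lambda>v. P (f v) (g v) (h v))"
  unfolding decidable_def by (rule recfn_comp3[of "\<lambda>x y z. of_bool (P x y z)"])

lemmas recfn_intros =
  recfn_var recfn_Suc recfn_const recfn_add recfn_mult recfn_power recfn_diff recfn_sum
  recfn_if recfn_of_bool decidable_not decidable_conj decidable_disj decidable_imp decidable_iff decidable_le
  decidable_less decidable_eq decidable_Ex decidable_All

lemma computable_rel_if_decidable:
  assumes "decidable (\<lambda>v. (v 0, v (Suc 0)) \<in> R)"
  shows "computable_rel R"
proof -
  obtain n e where e: "\<And>v. evaluates (\<lambda>_. False) e (map v [0..<n])
      (of_bool ((v 0, v (Suc 0)) \<in> R))"
    using assms unfolding decidable_def recfn_def by blast
  \<comment> \<open>The arity \<open>n\<close> of \<open>e\<close> need not be 2. Inputs after the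
    second are set to 0, which is harmless because the predicate looks only at variables 0 and
    1.\<close>
  define c where "c = (\<lambda>i::nat. if i < 2 then Proj i else Zero)"
  have "evaluates (\<lambda>_. False) (Comp e (map c [0..<n])) [x, y] (of_bool ((x, y) \<in> R))" for x y
  proof -
    define v where "v = (\<lambda>i::nat. if i < 2 then [x, y] ! i else 0)"
    have "evaluates (\<lambda>_. False) (c i) [x, y] (v i)" for i
      using evaluates.proj[of i "[x, y]"] evaluates.zero by (auto simp: c_def v_def)
    then have "list_all2 (\<lambda>g z. evaluates (\<lambda>_. False) g [x, y] z) (map c [0..<n]) (map v [0..<n])"
      by (simp add: list_all2_conv_all_nth)
    from evaluates.comp[OF this e] show ?thesis by (simp add: v_def)
  qed
  then show ?thesis unfolding computable_rel_def by blast
qed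

section \<open>Decidability of derivations\<close>

lemma recfn_prod_encode: "recfn f \<Longrightarrow> recfn g \<Longrightarrow> recfn (\<lambda>v. prod_encode (f v, g v))"
proof -
  have eq: "prod_encode (m, n) = (\<Sum>k<Suc (m + n). k) + m" for m n
    by (simp add: prod_encode_def triangle_def lessThan_Suc_atMost gauss_sum_nat atMost_atLeast0)
  show "recfn f \<Longrightarrow> recfn g \<Longrightarrow> ?thesis"
    unfolding eq by (intro recfn_intros)
qed

definition pfst :: "nat \<Rightarrow> nat" where "pfst z = fst (prod_decode z)"
definition psnd :: "nat \<Rightarrow> nat" where "psnd z = snd (prod_decode z)"

lemma pfst_encode [simp]: "pfst (prod_encode (a, b)) = a"
  and psnd_encode [simp]: "psnd (prod_encode (a, b)) = b"
  by (simp_all add: pfst_def psnd_def)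

lemma prod_encode_pfst_psnd: "prod_encode (pfst z, psnd z) = z"
  by (simp add: pfst_def psnd_def)

lemma pfst_le: "pfst z \<le> z"
  by (metis le_prod_encode_1 prod_encode_pfst_psnd)

lemma psnd_le: "psnd z \<le> z"
  by (metis le_prod_encode_2 prod_encode_pfst_psnd)

lemma recfn_pfst: "recfn f \<Longrightarrow> recfn (\<lambda>v. pfst (f v))"
proof (rule recfn_comp1[of pfst])
  show "recfn (\<lambda>v. pfst (v 0))"
  proof (rule recfn_unique)
    show "recfn (\<lambda>v. Suc (v 0))"
      by (intro recfn_intros)
    show "decidable (\<lambda>w. \<exists>j<Suc (w (Suc 0)). prod_encode (w 0, j) = w (Suc 0))"
      by (intro recfn_intros recfn_prod_encode)
    fix v :: "nat \<Rightarrow> nat" and k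
    show "pfst (v 0) < Suc (v 0)"
      using pfst_le by (simp add: less_Suc_eq_le)
    show "(\<exists>j<Suc (v 0). prod_encode (k, j) = v 0) \<longleftrightarrow> k = pfst (v 0)"
      by (metis less_Suc_eq_le pfst_encode prod_encode_pfst_psnd psnd_le)
  qed
qed

lemma recfn_psnd: "recfn f \<Longrightarrow> recfn (\<lambda>v. psnd (f v))"
proof (rule recfn_comp1[of psnd])
  show "recfn (\<lambda>v. psnd (v 0))"
  proof (rule recfn_unique)
    show "recfn (\<lambda>v. Suc (v 0))"
      by (intro recfn_intros)
    show "decidable (\<lambda>w. \<exists>j<Suc (w (Suc 0)). prod_encode (j, w 0) = w (Suc 0))"
      by (intro recfn_intros recfn_prod_encode)
    fix v :: "nat \<Rightarrow> nat" and k
    show "psnd (v 0) < Suc (v 0)"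
      using psnd_le by (simp add: less_Suc_eq_le)
    show "(\<exists>j<Suc (v 0). prod_encode (j, k) = v 0) \<longleftrightarrow> k = psnd (v 0)"
      by (metis less_Suc_eq_le psnd_encode prod_encode_pfst_psnd pfst_le)
  qed
qed

text \<open>The digit is the parity of a quotient, and the quotient is found by bounded search from
  the two inequalities that characterize it.\<close>

lemma decidable_bit: "recfn f \<Longrightarrow> recfn g \<Longrightarrow> decidable (\<lambda>v. bit (f v) (g v))"
proof (rule decidable_subst2[of bit])
  have div: "recfn (\<lambda>v. v 0 div 2 ^ v (Suc 0))"
  proof (rule recfn_unique)
    show "recfn (\<lambda>v. Suc (v 0))"
      by (intro recfn_intros)
    show "decidable (\<lambda>w. w 0 * 2 ^ w (Suc (Suc 0)) \<le> w (Suc 0) \<and>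
        w (Suc 0) < Suc (w 0) * 2 ^ w (Suc (Suc 0)))"
      by (intro recfn_intros)
    fix v :: "nat \<Rightarrow> nat" and k
    show "v 0 div 2 ^ v (Suc 0) < Suc (v 0)"
      by (simp add: less_Suc_eq_le)
    show "k * 2 ^ v (Suc 0) \<le> v 0 \<and> v 0 < Suc k * 2 ^ v (Suc 0) \<longleftrightarrow> k = v 0 div 2 ^ v (Suc 0)"
      by (metis div_less_iff_less_mult div_nat_eqI less_eq_div_iff_mult_less_eq mult.commute order_refl
          less_Suc_eq_le zero_less_numeral zero_less_power lessI)
  qed
  have odd: "decidable (\<lambda>v. \<exists>k<Suc (v 0). v 0 = Suc (2 * k))"
    by (intro recfn_intros)
  have eq: "bit m n \<longleftrightarrow> (\<exists>k<Suc (m div 2 ^ n). m div 2 ^ n = Suc (2 * k))" for m n :: nat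
    unfolding bit_iff_odd by (auto elim!: oddE)
  show "decidable (\<lambda>v. bit (v 0) (v (Suc 0)))"
    unfolding eq by (rule decidable_subst1[OF odd div])
qed

text \<open>The code of the empty list is 0 and every other code is the successor of a pair. So a
  comparison with 0 tests for emptiness, and subtracting 1 exposes head and tail.\<close>

definition hdc :: "nat \<Rightarrow> nat" where "hdc z = pfst (z - 1)"
definition tlc :: "nat \<Rightarrow> nat" where "tlc z = psnd (z - 1)"
definition consc :: "nat \<Rightarrow> nat \<Rightarrow> nat" where "consc x z = Suc (prod_encode (x, z))"
primrec dropc :: "nat \<Rightarrow> nat \<Rightarrow> nat" where
  "dropc 0 z = z"
| "dropc (Suc k) z = tlc (dropc k z)"

lemma consc_list_encode [simp]: "consc x (list_encode xs) = list_encode (x # xs)"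
  by (simp add: consc_def)

lemma hdc_list_encode [simp]: "hdc (list_encode (x # xs)) = x"
  by (simp add: hdc_def)

lemma tlc_list_encode [simp]: "tlc (list_encode xs) = list_encode (tl xs)"
proof (cases xs)
  case Nil
  have "psnd 0 = 0" using psnd_le[of 0] by simp
  then show ?thesis by (simp add: tlc_def Nil)
qed (simp add: tlc_def)

lemma dropc_list_encode [simp]: "dropc k (list_encode xs) = list_encode (drop k xs)"
  by (induction k) (simp_all add: drop_Suc tl_drop)

lemma list_encode_eq_0 [simp]: "list_encode xs = 0 \<longleftrightarrow> xs = []"
  by (cases xs) auto

lemma hdc_list_encode_drop [simp]: "k < length xs \<Longrightarrow> hdc (list_encode (drop k xs)) = xs ! k"
  by (metis Cons_nth_drop_Suc hdc_list_encode)

text \<open>Together with the bound on the length, this lets searches through a list be bounded by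
  its code.\<close>

lemma less_list_encode: "x \<in> set xs \<Longrightarrow> x < list_encode xs"
proof (induction xs)
  case (Cons a xs)
  have "a \<le> prod_encode (a, list_encode xs)" "list_encode xs \<le> prod_encode (a, list_encode xs)"
    by (rule le_prod_encode_1 le_prod_encode_2)+
  then show ?case using Cons by auto
qed simp

lemma length_le_list_encode: "length xs \<le> list_encode xs"
proof (induction xs)
  case (Cons a xs)
  have "list_encode xs \<le> prod_encode (a, list_encode xs)" by (rule le_prod_encode_2)
  then show ?case using Cons by auto
qed simp

lemma recfn_hdc: "recfn f \<Longrightarrow> recfn (\<lambda>v. hdc (f v))"
  unfolding hdc_def by (intro recfn_pfst recfn_intros)

lemma recfn_tlc: "recfn f \<Longrightarrow> recfn (\<lambda>v. tlc (f v))"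
  unfolding tlc_def by (intro recfn_psnd recfn_intros)

lemma recfn_consc: "recfn f \<Longrightarrow> recfn g \<Longrightarrow> recfn (\<lambda>v. consc (f v) (g v))"
  unfolding consc_def by (intro recfn_prod_encode recfn_intros)

lemma recfn_dropc: "recfn f \<Longrightarrow> recfn g \<Longrightarrow> recfn (\<lambda>v. dropc (f v) (g v))"
proof -
  have eq: "dropc k z = rec_nat z (\<lambda>_ r. tlc r) k" for k z
    by (induction k) auto
  show "recfn f \<Longrightarrow> recfn g \<Longrightarrow> ?thesis"
    unfolding eq by (intro recfn_rec recfn_tlc recfn_intros)
qed

lemmas recfn_code_intros = recfn_prod_encode recfn_pfst recfn_psnd decidable_bit recfn_hdc
  recfn_tlc recfn_consc recfn_dropc

section \<open>Codes of programs, and derivations\<close>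

fun prog_encode :: "prog \<Rightarrow> nat" where
  "prog_encode Zero = prod_encode (0, 0)"
| "prog_encode Succ = prod_encode (1, 0)"
| "prog_encode (Proj i) = prod_encode (2, i)"
| "prog_encode Query = prod_encode (3, 0)"
| "prog_encode (Comp f gs) =
     prod_encode (4, prod_encode (prog_encode f, list_encode (map prog_encode gs)))"
| "prog_encode (PrimRec f g) = prod_encode (5, prod_encode (prog_encode f, prog_encode g))"
| "prog_encode (Mu f) = prod_encode (6, prog_encode f)"

text \<open>A fact \<open>fact_code c x y\<close> claims that the program with code \<open>c\<close> has output \<open>y\<close> on the
  input list with code \<open>x\<close>. A derivation is a list of facts, each of which follows from the
  facts after it by one rule of \<^const>\<open>evaluates\<close>.\<close>

definition fact_code :: "nat \<Rightarrow> nat \<Rightarrow> nat \<Rightarrow> nat" where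
  "fact_code c x y = prod_encode (c, prod_encode (x, y))"

text \<open>The clauses follow the rules of \<open>evaluates\<close>, selected by the tags of
  \<open>prog_encode\<close>. For tag 4, \<open>z\<close> codes the list of intermediate values;
  that both lists run out at the same \<open>j\<close> forces equal lengths.\<close>

definition justified :: "(nat \<Rightarrow> bool) \<Rightarrow> nat set \<Rightarrow> nat \<Rightarrow> nat \<Rightarrow> nat \<Rightarrow> bool" where
  "justified X M c x y \<longleftrightarrow>
     pfst c = 0 \<and> y = 0 \<or>
     pfst c = 1 \<and> x \<noteq> 0 \<and> tlc x = 0 \<and> y = Suc (hdc x) \<or>
     pfst c = 2 \<and> dropc (psnd c) x \<noteq> 0 \<and> y = hdc (dropc (psnd c) x) \<or>
     pfst c = 3 \<and> x \<noteq> 0 \<and> tlc x = 0 \<and> y = of_bool (X (hdc x)) \<or>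
     pfst c = 4 \<and> (\<exists>z. fact_code (pfst (psnd c)) z y \<in> M \<and>
       (\<forall>j. (dropc j (psnd (psnd c)) = 0 \<longleftrightarrow> dropc j z = 0) \<and>
         (dropc j (psnd (psnd c)) \<noteq> 0 \<longrightarrow>
            fact_code (hdc (dropc j (psnd (psnd c)))) x (hdc (dropc j z)) \<in> M))) \<or>
     pfst c = 5 \<and> x \<noteq> 0 \<and> hdc x = 0 \<and> fact_code (pfst (psnd c)) (tlc x) y \<in> M \<or>
     pfst c = 5 \<and> x \<noteq> 0 \<and> 0 < hdc x \<and>
       (\<exists>r. fact_code c (consc (hdc x - 1) (tlc x)) r \<in> M \<and>
         fact_code (psnd (psnd c)) (consc (hdc x - 1) (consc r (tlc x))) y \<in> M) \<or>
     pfst c = 6 \<and> fact_code (psnd c) (consc y x) 0 \<in> M \<and>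
       (\<forall>m<y. \<exists>k. 0 < k \<and> fact_code (psnd c) (consc m x) k \<in> M)"

primrec derivation :: "(nat \<Rightarrow> bool) \<Rightarrow> nat list \<Rightarrow> bool" where
  "derivation X [] = True"
| "derivation X (F # D) \<longleftrightarrow>
     justified X (set D) (pfst F) (pfst (psnd F)) (psnd (psnd F)) \<and> derivation X D"

text \<open>\<open>M\<close> occurs only positively, so monotonicity of the connectives
  suffices.\<close>

lemma justified_mono:
  assumes "justified X M c x y" "M \<subseteq> N"
  shows "justified X N c x y"
proof -
  have sub: "F \<in> M \<longrightarrow> F \<in> N" for F using assms(2) by blast
  have "justified X M c x y \<longrightarrow> justified X N c x y"
    unfolding justified_def
    by (rule imp_refl sub disj_mono conj_mono ex_mono all_mono imp_mono)+
  then show ?thesis using assms(1) by blast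
qed

lemma derivation_append: "derivation X D \<Longrightarrow> derivation X E \<Longrightarrow> derivation X (D @ E)"
  by (induction D) (auto elim!: justified_mono)

text \<open>Composition and minimization have a varying number of premises; concatenation gives one
  derivation that contains them all.\<close>

lemma derivation_collect:
  fixes n :: nat
  assumes "\<And>j. j < n \<Longrightarrow> \<exists>D. derivation X D \<and> P j \<in> set D"
  shows "\<exists>D. derivation X D \<and> (\<forall>j<n. P j \<in> set D)"
  using assms
proof (induction n)
  case 0
  show ?case by (intro exI[of _ "[]"]) simp
next
  case (Suc n)
  obtain D where "derivation X D" "\<forall>j<n. P j \<in> set D"
    using Suc by (meson less_SucI)
  moreover obtain E where "derivation X E" "P n \<in> set E"
    using Suc.prems by blast
  ultimately have "derivation X (D @ E) \<and> (\<forall>j<Suc n. P j \<in> set (D @ E))"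
    by (auto simp: derivation_append less_Suc_eq)
  then show ?case by blast
qed

lemma derivation_extend:
  assumes "derivation X D" "justified X (set D) c x y"
  shows "\<exists>D. derivation X D \<and> fact_code c x y \<in> set D"
  using assms by (intro exI[of _ "fact_code c x y # D"]) (simp add: fact_code_def)

text \<open>Each rule puts its conclusion in front of the concatenated derivations of its
  premises.\<close>

lemma evaluates_imp_derivation:
  "evaluates X e xs y \<Longrightarrow>
     \<exists>D. derivation X D \<and> fact_code (prog_encode e) (list_encode xs) y \<in> set D"
proof (induction rule: evaluates.induct)
  case (zero xs)
  show ?case by (rule derivation_extend[of X "[]"]) (simp_all add: justified_def)
next
  case (succ x)
  show ?case
    by (rule derivation_extend[of X "[]"]) (simp_all add: justified_def del: list_encode.simps)
next
  case (proj i xs)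
  then show ?case
    by (intro derivation_extend[of X "[]"]) (simp_all add: justified_def)
next
  case (query x)
  show ?case
    by (rule derivation_extend[of X "[]"]) (simp_all add: justified_def del: list_encode.simps)
next
  case (comp xs gs ys f z)
  have len: "length gs = length ys" using comp(1) by (rule list_all2_lengthD)
  have "\<exists>D. derivation X D \<and>
      (\<forall>j<length gs. fact_code (prog_encode (gs ! j)) (list_encode xs) (ys ! j) \<in> set D)"
    using comp(1) by (intro derivation_collect) (auto simp: list_all2_conv_all_nth)
  then obtain D where D: "derivation X D"
    "\<forall>j<length gs. fact_code (prog_encode (gs ! j)) (list_encode xs) (ys ! j) \<in> set D" by blast
  obtain E where E: "derivation X E" "fact_code (prog_encode f) (list_encode ys) z \<in> set E"
    using comp by blast
  have "\<forall>j. (dropc j (list_encode (map prog_encode gs)) = 0 \<longleftrightarrow> dropc j (list_encode ys) = 0) \<and>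
      (dropc j (list_encode (map prog_encode gs)) \<noteq> 0 \<longrightarrow>
        fact_code (hdc (dropc j (list_encode (map prog_encode gs)))) (list_encode xs)
          (hdc (dropc j (list_encode ys))) \<in> set (D @ E))"
    using D(2) len by (auto simp del: drop_map)
  moreover have "fact_code (prog_encode f) (list_encode ys) z \<in> set (D @ E)" using E by simp
  ultimately have "justified X (set (D @ E)) (prog_encode (Comp f gs)) (list_encode xs) z"
    unfolding justified_def prog_encode.simps pfst_encode psnd_encode by blast
  then show ?case by (rule derivation_extend[OF derivation_append[OF D(1) E(1)]])
next
  case (primrec_0 f xs y g)
  then obtain D where "derivation X D" "fact_code (prog_encode f) (list_encode xs) y \<in> set D" by blast
  then show ?case
    by (intro derivation_extend[of X D]) (simp_all add: justified_def del: list_encode.simps(2))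
next
  case (primrec_Suc f g n xs r y)
  then obtain D E where D: "derivation X D"
      "fact_code (prog_encode (PrimRec f g)) (list_encode (n # xs)) r \<in> set D"
    and E: "derivation X E" "fact_code (prog_encode g) (list_encode (n # r # xs)) y \<in> set E"
    by blast
  have "justified X (set (D @ E)) (prog_encode (PrimRec f g)) (list_encode (Suc n # xs)) y"
    unfolding justified_def using D(2) E(2)
    by (auto simp del: list_encode.simps(2))
  then show ?case by (rule derivation_extend[OF derivation_append[OF D(1) E(1)]])
next
  case (mu f n xs)
  then obtain k where k: "\<And>m. m < n \<Longrightarrow> 0 < k m \<and>
      (\<exists>D. derivation X D \<and> fact_code (prog_encode f) (list_encode (m # xs)) (k m) \<in> set D)"
    by metis
  then have "\<exists>D. derivation X D \<and>
      (\<forall>m<n. fact_code (prog_encode f) (list_encode (m # xs)) (k m) \<in> set D)"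
    by (intro derivation_collect) blast
  then obtain D where D: "derivation X D"
    "\<forall>m<n. fact_code (prog_encode f) (list_encode (m # xs)) (k m) \<in> set D" by blast
  obtain E where E: "derivation X E" "fact_code (prog_encode f) (list_encode (n # xs)) 0 \<in> set E"
    using mu by blast
  have "justified X (set (D @ E)) (prog_encode (Mu f)) (list_encode xs) n"
    unfolding justified_def using D(2) E(2) k
    by (auto simp del: list_encode.simps(2))
  then show ?case by (rule derivation_extend[OF derivation_append[OF D(1) E(1)]])
qed

lemma list_encode_cases: "\<exists>xs. z = list_encode xs"
  by (metis list_decode_inverse)

text \<open>A fact about \<open>e\<close> is justified by facts about \<open>e\<close> and its
  subprograms only, so facts in \<open>D\<close> whose code belongs to no program do no
  harm.\<close>

lemma derivation_imp_evaluates: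
  "derivation X D \<Longrightarrow> fact_code (prog_encode e) (list_encode xs) y \<in> set D \<Longrightarrow> evaluates X e xs y"
proof (induction D arbitrary: e xs y)
  case (Cons F D)
  have IH: "evaluates X e' xs' y'"
    if "fact_code (prog_encode e') (list_encode xs') y' \<in> set D" for e' xs' y'
    using Cons.IH Cons.prems(1) that by simp
  show ?case
  proof (cases "fact_code (prog_encode e) (list_encode xs) y \<in> set D")
    case True
    then show ?thesis by (rule IH)
  next
    case False
    then have "F = fact_code (prog_encode e) (list_encode xs) y" using Cons.prems(2) by simp
    then have J: "justified X (set D) (prog_encode e) (list_encode xs) y"
      using Cons.prems(1) by (simp add: fact_code_def)
    show ?thesis
    proof (cases e)
      case Zero
      then show ?thesis using J evaluates.zero by (simp add: justified_def)
    next
      case Succ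
      then show ?thesis using J evaluates.succ
        by (cases xs) (auto simp: justified_def simp del: list_encode.simps(2))
    next
      case (Proj i)
      then show ?thesis using J evaluates.proj[of i xs X] by (auto simp: justified_def)
    next
      case Query
      then show ?thesis using J evaluates.query[of X]
        by (cases xs) (auto simp: justified_def simp del: list_encode.simps(2))
    next
      case (Comp f gs)
      obtain z where z: "fact_code (prog_encode f) z y \<in> set D"
        and gs: "\<And>j. (dropc j (list_encode (map prog_encode gs)) = 0 \<longleftrightarrow> dropc j z = 0) \<and>
         (dropc j (list_encode (map prog_encode gs)) \<noteq> 0 \<longrightarrow>
            fact_code (hdc (dropc j (list_encode (map prog_encode gs)))) (list_encode xs)
              (hdc (dropc j z)) \<in> set D)"
        using J by (auto simp: justified_def Comp simp del: dropc_list_encode)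
      obtain ys where ys: "z = list_encode ys" using list_encode_cases by blast
      have le: "length gs \<le> j \<longleftrightarrow> length ys \<le> j" for j
        using gs[of j] by (simp add: ys)
      have len: "length gs = length ys" using le[of "length gs"] le[of "length ys"] by simp
      have "evaluates X (gs ! j) xs (ys ! j)" if "j < length gs" for j
        using gs[of j] that len by (intro IH) (simp add: ys del: drop_map)
      then have "list_all2 (\<lambda>g y. evaluates X g xs y) gs ys"
        by (simp add: list_all2_conv_all_nth len)
      then show ?thesis unfolding Comp using z IH ys by (intro evaluates.comp[of X xs gs ys]) auto
    next
      case (PrimRec f g)
      then obtain n zs where xs: "xs = n # zs"
        using J by (cases xs) (auto simp: justified_def)
      show ?thesis
      proof (cases n)
        case 0
        then show ?thesis using J IH unfolding PrimRec xs 0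
          by (intro evaluates.primrec_0) (auto simp: justified_def simp del: list_encode.simps(2))
      next
        case (Suc m)
        then obtain r where "fact_code (prog_encode e) (list_encode (m # zs)) r \<in> set D"
          "fact_code (prog_encode g) (list_encode (m # r # zs)) y \<in> set D"
          using J by (auto simp: PrimRec xs justified_def simp del: list_encode.simps(2))
        then show ?thesis unfolding PrimRec xs Suc
          by (intro evaluates.primrec_Suc[of X f g m zs r] IH)
      qed
    next
      case (Mu f)
      have "fact_code (prog_encode f) (list_encode (y # xs)) 0 \<in> set D"
        "\<And>m. m < y \<Longrightarrow> \<exists>k>0. fact_code (prog_encode f) (list_encode (m # xs)) k \<in> set D"
        using J by (auto simp: Mu justified_def simp del: list_encode.simps(2))
      then show ?thesis unfolding Mu using IH by (intro evaluates.mu) blast+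
    qed
  qed
qed simp

lemma justified_cong:
  assumes "\<And>i. i < b \<Longrightarrow> X i = Y i" "hdc x < b"
  shows "justified X M c x y = justified Y M c x y"
  using assms unfolding justified_def by simp

text \<open>The use principle: every queried number occurs in a fact of the derivation and is
  therefore below the code of the whole list.\<close>

lemma derivation_cong:
  assumes "\<And>i. i < list_encode D \<Longrightarrow> X i = Y i"
  shows "derivation X D = derivation Y D"
  using assms
proof (induction D)
  case (Cons F D)
  have le: "list_encode D \<le> prod_encode (F, list_encode D)" by (rule le_prod_encode_2)
  have "hdc (pfst (psnd F)) \<le> pfst (psnd F)"
    unfolding hdc_def using pfst_le[of "pfst (psnd F) - 1"] by linarith
  also have "\<dots> \<le> F" using pfst_le[of "psnd F"] psnd_le[of F] by linarith
  also have "\<dots> < list_encode (F # D)" by (rule less_list_encode) simp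
  finally have "justified X (set D) (pfst F) (pfst (psnd F)) (psnd (psnd F)) =
      justified Y (set D) (pfst F) (pfst (psnd F)) (psnd (psnd F))"
    using Cons.prems by (intro justified_cong)
  moreover have "derivation X D = derivation Y D"
    using le by (intro Cons.IH Cons.prems) simp
  ultimately show ?case by simp
qed simp

section \<open>Checking derivations by bounded search\<close>

definition memc :: "nat \<Rightarrow> nat \<Rightarrow> bool" where
  "memc F D \<longleftrightarrow> (\<exists>k<D. dropc k D \<noteq> 0 \<and> hdc (dropc k D) = F)"

lemma memc_list_encode: "memc F (list_encode D) \<longleftrightarrow> F \<in> set D"
proof
  assume "F \<in> set D"
  then obtain k where "k < length D" "D ! k = F" by (auto simp: in_set_conv_nth)
  then show "memc F (list_encode D)"
    unfolding memc_def using length_le_list_encode[of D] by (intro exI[of _ k]) auto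
qed (auto simp: memc_def)

lemma decidable_memc: "recfn f \<Longrightarrow> recfn g \<Longrightarrow> decidable (\<lambda>v. memc (f v) (g v))"
proof (rule decidable_subst2[of memc])
  show "decidable (\<lambda>v. memc (v 0) (v (Suc 0)))"
    unfolding memc_def by (intro recfn_intros recfn_code_intros)
qed

lemma fact_code_bounds: "c \<le> fact_code c x y" "x \<le> fact_code c x y" "y \<le> fact_code c x y"
  unfolding fact_code_def
  by (meson le_prod_encode_1 le_prod_encode_2 order_trans)+

lemma fact_memc_less:
  assumes "memc (fact_code c x y) D"
  shows "x < D" "y < D"
proof -
  obtain Ds where "D = list_encode Ds" using list_encode_cases by blast
  then have "fact_code c x y < D" using assms memc_list_encode less_list_encode by simp
  then show "x < D" "y < D" 
    using fact_code_bounds(2)[of x c y] fact_code_bounds(3)[of y c x] by linarith+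
qed

lemma dropc_eq_0: "z \<le> j \<Longrightarrow> dropc j z = 0"
proof -
  assume "z \<le> j"
  obtain zs where "z = list_encode zs" using list_encode_cases by blast
  then show ?thesis using \<open>z \<le> j\<close> length_le_list_encode[of zs] by simp
qed

text \<open>The clauses of \<open>justified\<close> with the oracle given by the binary digits of
  \<open>\<sigma>\<close>, the known facts by the list code \<open>D\<close>, and every quantifier
  bounded.\<close>

definition justified_bounded :: "nat \<Rightarrow> nat \<Rightarrow> nat \<Rightarrow> nat \<Rightarrow> nat \<Rightarrow> bool" where
  "justified_bounded \<sigma> D c x y \<longleftrightarrow>
     pfst c = 0 \<and> y = 0 \<or>
     pfst c = 1 \<and> x \<noteq> 0 \<and> tlc x = 0 \<and> y = Suc (hdc x) \<or>
     pfst c = 2 \<and> dropc (psnd c) x \<noteq> 0 \<and> y = hdc (dropc (psnd c) x) \<or>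
     pfst c = 3 \<and> x \<noteq> 0 \<and> tlc x = 0 \<and> y = of_bool (bit \<sigma> (hdc x)) \<or>
     pfst c = 4 \<and> (\<exists>z<D. memc (fact_code (pfst (psnd c)) z y) D \<and>
       (\<forall>j<psnd (psnd c) + z. (dropc j (psnd (psnd c)) = 0 \<longleftrightarrow> dropc j z = 0) \<and>
         (dropc j (psnd (psnd c)) \<noteq> 0 \<longrightarrow>
            memc (fact_code (hdc (dropc j (psnd (psnd c)))) x (hdc (dropc j z))) D))) \<or>
     pfst c = 5 \<and> x \<noteq> 0 \<and> hdc x = 0 \<and> memc (fact_code (pfst (psnd c)) (tlc x) y) D \<or>
     pfst c = 5 \<and> x \<noteq> 0 \<and> 0 < hdc x \<and>
       (\<exists>r<D. memc (fact_code c (consc (hdc x - 1) (tlc x)) r) D \<and>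
         memc (fact_code (psnd (psnd c)) (consc (hdc x - 1) (consc r (tlc x))) y) D) \<or>
     pfst c = 6 \<and> memc (fact_code (psnd c) (consc y x) 0) D \<and>
       (\<forall>m<y. \<exists>k<D. 0 < k \<and> memc (fact_code (psnd c) (consc m x) k) D)"

text \<open>The witnesses \<open>z\<close>, \<open>r\<close> and \<open>k\<close> occur in facts of
  the list and hence are below its code. From \<open>psnd (psnd c) + z\<close> on both dropped lists
  are empty, so larger \<open>j\<close> impose no condition.\<close>

lemma justified_bounded:
  "justified_bounded \<sigma> (list_encode D) c x y \<longleftrightarrow> justified (bit \<sigma>) (set D) c x y"
proof -
  let ?D = "list_encode D"
  have comp: "(\<exists>z<?D. memc (fact_code (pfst (psnd c)) z y) ?D \<and>
       (\<forall>j<psnd (psnd c) + z. (dropc j (psnd (psnd c)) = 0 \<longleftrightarrow> dropc j z = 0) \<and>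
         (dropc j (psnd (psnd c)) \<noteq> 0 \<longrightarrow>
            memc (fact_code (hdc (dropc j (psnd (psnd c)))) x (hdc (dropc j z))) ?D))) \<longleftrightarrow>
     (\<exists>z. memc (fact_code (pfst (psnd c)) z y) ?D \<and>
       (\<forall>j. (dropc j (psnd (psnd c)) = 0 \<longleftrightarrow> dropc j z = 0) \<and>
         (dropc j (psnd (psnd c)) \<noteq> 0 \<longrightarrow>
            memc (fact_code (hdc (dropc j (psnd (psnd c)))) x (hdc (dropc j z))) ?D)))"
    (is "(\<exists>z<_. ?M z \<and> (\<forall>j<_. ?P j z)) \<longleftrightarrow> (\<exists>z. ?M z \<and> (\<forall>j. ?P j z))")
  proof -
    have "?P j z" if "psnd (psnd c) + z \<le> j" for j z
      using that by (simp add: dropc_eq_0)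
    then have "(\<forall>j<psnd (psnd c) + z. ?P j z) \<longleftrightarrow> (\<forall>j. ?P j z)" for z
      by (meson not_le)
    then show ?thesis using fact_memc_less(1) by meson
  qed
  have prec: "(\<exists>r<?D. memc (fact_code c u r) ?D \<and> Q r) \<longleftrightarrow> (\<exists>r. memc (fact_code c u r) ?D \<and> Q r)"
    for u Q using fact_memc_less(2) by meson
  have mu: "(\<exists>k<?D. 0 < k \<and> memc (fact_code c u k) ?D) \<longleftrightarrow> (\<exists>k. 0 < k \<and> memc (fact_code c u k) ?D)"
    for c u using fact_memc_less(2) by meson
  show ?thesis
    unfolding justified_bounded_def comp prec mu
    unfolding justified_def memc_list_encode by (rule refl)
qed

lemma decidable_justified_bounded:
  assumes "recfn s" "recfn d" "recfn f" "recfn g" "recfn h"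
  shows "decidable (\<lambda>v. justified_bounded (s v) (d v) (f v) (g v) (h v))"
proof -
  have "decidable (\<lambda>v. justified_bounded (v 0) (v 1) (v 2) (v 3) (v 4))"
    unfolding justified_bounded_def fact_code_def One_nat_def
    by (intro recfn_intros recfn_code_intros decidable_memc)
  from recfn_subst[OF this[unfolded decidable_def],
      of "\<lambda>i. if i = 0 then s else if i = 1 then d else if i = 2 then f else if i = 3 then g else h"]
  show ?thesis unfolding decidable_def using assms by simp
qed

text \<open>The recursion of \<open>derivation\<close> becomes a bounded quantifier over the
  suffixes of the list.\<close>

definition derivationc :: "nat \<Rightarrow> nat \<Rightarrow> bool" where
  "derivationc \<sigma> D \<longleftrightarrow> (\<forall>k<D. dropc k D \<noteq> 0 \<longrightarrow>
     justified_bounded \<sigma> (dropc (Suc k) D) (pfst (hdc (dropc k D)))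
       (pfst (psnd (hdc (dropc k D)))) (psnd (psnd (hdc (dropc k D)))))"

lemma derivation_iff_nth:
  "derivation X D \<longleftrightarrow> (\<forall>k<length D. justified X (set (drop (Suc k) D)) (pfst (D ! k))
     (pfst (psnd (D ! k))) (psnd (psnd (D ! k))))"
  by (induction D) (auto simp: less_Suc_eq_0_disj)

lemma derivationc: "derivationc \<sigma> (list_encode D) \<longleftrightarrow> derivation (bit \<sigma>) D"
proof -
  have "derivationc \<sigma> (list_encode D) \<longleftrightarrow> (\<forall>k<length D. justified_bounded \<sigma>
      (list_encode (drop (Suc k) D)) (pfst (D ! k)) (pfst (psnd (D ! k))) (psnd (psnd (D ! k))))"
    unfolding derivationc_def dropc_list_encode list_encode_eq_0
    using length_le_list_encode[of D] by auto
  then show ?thesis by (simp add: justified_bounded derivation_iff_nth)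
qed

lemma decidable_derivationc: "recfn f \<Longrightarrow> recfn g \<Longrightarrow> decidable (\<lambda>v. derivationc (f v) (g v))"
proof (rule decidable_subst2[of derivationc])
  show "decidable (\<lambda>v. derivationc (v 0) (v (Suc 0)))"
    unfolding derivationc_def
    by (intro recfn_intros recfn_code_intros decidable_justified_bounded)
qed

section \<open>Oracles that produce an element of an interval\<close>

text \<open>The same \<open>b\<close> bounds the element and the derivation that certifies it. So
  the predicate depends on the first \<open>b\<close> digits of the oracle only, and it is monotone
  in \<open>b\<close>.\<close>

definition hits :: "(nat \<Rightarrow> bool) \<Rightarrow> nat \<Rightarrow> nat \<Rightarrow> nat \<Rightarrow> bool" where
  "hits X c a b \<longleftrightarrow> (\<exists>x D. a \<le> x \<and> x < b \<and> list_encode D < b \<and> derivation X D \<and>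
     fact_code c (list_encode [x]) 1 \<in> set D)"

lemma hits_cong:
  assumes "\<And>i. i < b \<Longrightarrow> X i = Y i"
  shows "hits X c a b = hits Y c a b"
proof -
  have "derivation X D = derivation Y D" if "list_encode D < b" for D
    using assms that by (intro derivation_cong) simp
  then show ?thesis unfolding hits_def by blast
qed

lemma hits_mono: "hits X c a b \<Longrightarrow> b \<le> b' \<Longrightarrow> a' \<le> a \<Longrightarrow> hits X c a' b'"
  unfolding hits_def by (meson le_trans less_le_trans)

lemma evaluates_imp_hits:
  assumes "evaluates X e [x] 1" "a \<le> x"
  shows "\<exists>b. hits X (prog_encode e) a b"
proof -
  obtain D where "derivation X D" "fact_code (prog_encode e) (list_encode [x]) 1 \<in> set D"
    using evaluates_imp_derivation[OF assms(1)] by blast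
  then show ?thesis
    unfolding hits_def using assms(2)
    by (intro exI[of _ "Suc (x + list_encode D)"] exI[of _ x] exI[of _ D]) simp
qed

lemma hits_imp_evaluates:
  assumes "hits X (prog_encode e) a b"
  shows "\<exists>x. a \<le> x \<and> x < b \<and> evaluates X e [x] 1"
  using assms derivation_imp_evaluates unfolding hits_def by blast

lemma decidable_hits:
  assumes "recfn s" "recfn c" "recfn f" "recfn g"
  shows "decidable (\<lambda>v. hits (bit (s v)) (c v) (f v) (g v))"
proof -
  have eq: "hits (bit s) c a b \<longleftrightarrow> (\<exists>x<b. \<exists>D<b. a \<le> x \<and> derivationc s D \<and>
      memc (prod_encode (c, prod_encode (consc x 0, Suc 0))) D)" for s c a b
  proof -
    have "derivationc s (list_encode D) \<and>
        memc (prod_encode (c, prod_encode (consc x 0, Suc 0))) (list_encode D) \<longleftrightarrow>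
        derivation (bit s) D \<and> fact_code c (list_encode [x]) 1 \<in> set D" for x D
      by (simp add: derivationc memc_list_encode fact_code_def consc_def)
    then show ?thesis
      unfolding hits_def by (metis list_decode_inverse)
  qed
  have "decidable (\<lambda>v. hits (bit (v 0)) (v 1) (v 2) (v 3))"
    unfolding eq by (intro recfn_intros recfn_code_intros decidable_memc decidable_derivationc)
  from recfn_subst[OF this[unfolded decidable_def],
      of "\<lambda>i. if i = 0 then s else if i = 1 then c else if i = 2 then f else g"]
  show ?thesis unfolding decidable_def using assms by simp
qed

lemma list_all2_functional:
  assumes "list_all2 (\<lambda>g y. P g y \<and> (\<forall>y'. P g y' \<longrightarrow> y' = y)) gs ys" "list_all2 P gs zs"
  shows "zs = ys"
  using assms by (auto simp: list_all2_conv_all_nth intro!: nth_equalityI)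

text \<open>This turns an output 1, as found by \<open>hits\<close>, into membership in the set
  whose characteristic function the program computes.\<close>

lemma evaluates_deterministic: "evaluates X e xs y \<Longrightarrow> evaluates X e xs y' \<Longrightarrow> y' = y"
proof (induction arbitrary: y' rule: evaluates.induct)
  case (zero xs)
  then show ?case by (rule evaluates.cases) auto
next
  case (succ x)
  then show ?case by (rule evaluates.cases) auto
next
  case (proj i xs)
  from proj(2) show ?case by (rule evaluates.cases) auto
next
  case (query x)
  then show ?case by (rule evaluates.cases) auto
next
  case (comp xs gs ys f z)
  from comp.prems obtain zs where zs: "list_all2 (\<lambda>g y. evaluates X g xs y) gs zs"
    "evaluates X f zs y'"
    by (rule evaluates.cases) auto
  have "zs = ys"
    using comp(1) zs(1) by (intro list_all2_functional) (auto elim: list.rel_mono_strong)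
  then show ?case using comp.IH zs(2) by simp
next
  case (primrec_0 f xs y g)
  from primrec_0.prems have "evaluates X f xs y'" by (rule evaluates.cases) auto
  then show ?case by (rule primrec_0.IH)
next
  case (primrec_Suc f g n xs r y)
  from primrec_Suc.prems obtain r' where
    "evaluates X (PrimRec f g) (n # xs) r'" "evaluates X g (n # r' # xs) y'"
    by (rule evaluates.cases) auto
  then show ?case using primrec_Suc.IH by blast
next
  case (mu f n xs)
  from mu.prems have *: "evaluates X f (y' # xs) 0" "\<forall>m<y'. \<exists>k>0. evaluates X f (m # xs) k"
    by (rule evaluates.cases; auto)+
  \<comment> \<open>At the smaller of two different candidates one evaluation would give 0 and the
    other a positive value.\<close>
  have "\<not> y' < n" using mu(3) *(1) by (metis less_numeral_extra(3))
  moreover have "\<not> n < y'" using mu(2) *(2) by (metis less_numeral_extra(3))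
  ultimately show ?case by simp
qed

section \<open>Order type and patterns\<close>

text \<open>With finitely many predecessors everywhere, counting them is strictly monotone. Its
  range is unbounded and closed under predecessor, hence everything.\<close>

lemma rank_bij:
  assumes "trans L" "irrefl L" "total_on A L" "infinite A"
    and fin: "\<And>x. x \<in> A \<Longrightarrow> finite {y\<in>A. (y, x) \<in> L}"
  defines "rk \<equiv> \<lambda>x. card {y\<in>A. (y, x) \<in> L}"
  shows "bij_betw rk A UNIV" "\<And>x y. x \<in> A \<Longrightarrow> y \<in> A \<Longrightarrow> (x, y) \<in> L \<longleftrightarrow> rk x < rk y"
proof -
  have mono: "rk x < rk y" if "x \<in> A" "y \<in> A" "(x, y) \<in> L" for x y
  proof -
    have "{z\<in>A. (z, x) \<in> L} \<subset> {z\<in>A. (z, y) \<in> L}"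
      using that \<open>trans L\<close> \<open>irrefl L\<close> by (auto dest: transD simp: irrefl_def)
    then show ?thesis unfolding rk_def using fin[OF \<open>y \<in> A\<close>] by (rule psubset_card_mono[rotated])
  qed
  show iff: "(x, y) \<in> L \<longleftrightarrow> rk x < rk y" if "x \<in> A" "y \<in> A" for x y
    using mono that \<open>total_on A L\<close> unfolding total_on_def by (metis less_asym less_irrefl)
  have inj: "inj_on rk A"
    using mono \<open>total_on A L\<close> unfolding inj_on_def total_on_def by (metis less_irrefl)
  have down: "n \<in> rk ` A" if "Suc n \<in> rk ` A" for n
  proof -
    from that obtain x where "Suc n = rk x" and "x \<in> A" by (rule imageE)
    then have x: "x \<in> A" "rk x = Suc n" by simp_all
    define P where "P = {y\<in>A. (y, x) \<in> L}"
    have P: "finite P" "card P = Suc n" using fin[OF x(1)] x(2) by (simp_all add: P_def rk_def)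
    \<comment> \<open>The predecessor \<open>y\<close> of greatest rank is the immediate one: its
      predecessors are those of \<open>x\<close> except \<open>y\<close> itself.\<close>
    have "Max (rk ` P) \<in> rk ` P" using P by (intro Max_in) auto
    then obtain y where y: "y \<in> P" "rk y = Max (rk ` P)" by auto
    have max: "rk z \<le> rk y" if "z \<in> P" for z using that P(1) y(2) by simp
    have yA: "y \<in> A" "(y, x) \<in> L" using y(1) by (simp_all add: P_def)
    have "{z\<in>A. (z, y) \<in> L} = P - {y}"
    proof (intro equalityI subsetI)
      fix z assume "z \<in> {z\<in>A. (z, y) \<in> L}"
      then show "z \<in> P - {y}"
        using yA \<open>irrefl L\<close> transD[OF \<open>trans L\<close>, of z y x] by (auto simp: P_def irrefl_def)
    next
      fix z assume z: "z \<in> P - {y}"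
      then have "z \<in> A" "z \<noteq> y" by (simp_all add: P_def)
      moreover have "(y, z) \<notin> L" using iff[OF yA(1) \<open>z \<in> A\<close>] max[of z] z by simp
      ultimately show "z \<in> {z\<in>A. (z, y) \<in> L}"
        using yA(1) \<open>total_on A L\<close> unfolding total_on_def by blast
    qed
    then have "rk y = n" using P y(1) by (simp add: rk_def)
    then show ?thesis using y(1) by (auto simp: P_def)
  qed
  have "n \<in> rk ` A" for n
  proof -
    have "infinite (rk ` A)" using inj \<open>infinite A\<close> by (simp add: finite_image_iff)
    then obtain m where "n \<le> m" "m \<in> rk ` A"
      by (meson infinite_nat_iff_unbounded_le)
    then show ?thesis using down by (induction m rule: dec_induct) auto
  qed
  then show "bij_betw rk A UNIV" using inj by (auto simp: bij_betw_def)
qed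

text \<open>Ranks with respect to \<open>L\<close> number \<open>A\<close>, and ranks with respect
  to the converse number its complement.\<close>

lemma order_isomorphic_omega_plus_omega_star:
  fixes L :: "(nat \<times> nat) set"
  assumes L: "strict_linear_order L"
    and fin: "\<And>x. x \<in> A \<Longrightarrow> finite {y. (y, x) \<in> L}" "\<And>x. x \<notin> A \<Longrightarrow> finite {y. (x, y) \<in> L}"
    and inf: "infinite A" "infinite (- A)"
  shows "order_isomorphic L omega_plus_omega_star"
proof -
  have tr: "trans L" and ir: "irrefl L" and tot: "total L"
    using L by (simp_all add: strict_linear_order_on_def)
  define f where "f = (\<lambda>x. card {y\<in>A. (y, x) \<in> L})"
  define g where "g = (\<lambda>x. card {y\<in>-A. (y, x) \<in> L\<inverse>})"
  have f: "bij_betw f A UNIV" "\<And>x y. x \<in> A \<Longrightarrow> y \<in> A \<Longrightarrow> (x, y) \<in> L \<longleftrightarrow> f x < f y"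
    unfolding f_def using tr ir tot inf fin(1)
    by (intro rank_bij; auto intro: total_on_subset finite_subset[OF _ fin(1)])+
  have g: "bij_betw g (- A) UNIV"
    "\<And>x y. x \<in> - A \<Longrightarrow> y \<in> - A \<Longrightarrow> (x, y) \<in> L\<inverse> \<longleftrightarrow> g x < g y"
    unfolding g_def using tr ir tot inf fin(2)
    by (intro rank_bij; auto simp: irrefl_def total_on_def intro: finite_subset[OF _ fin(2)])+
  define h where "h = (\<lambda>x. if x \<in> A then Inl (f x) else Inr (g x))"
  have "bij h"
  proof (rule bijI)
    show "inj h"
      using f(1) g(1) by (auto simp: inj_def h_def bij_betw_def dest: inj_onD)
    show "surj h"
      unfolding surj_def
    proof
      fix z :: "nat + nat"
      show "\<exists>x. z = h x"
      proof (cases z)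
        case (Inl n)
        then show ?thesis using f(1) unfolding bij_betw_def h_def by (metis UNIV_I imageE)
      next
        case (Inr n)
        then show ?thesis using g(1) unfolding bij_betw_def h_def by (metis UNIV_I imageE ComplD)
      qed
    qed
  qed
  moreover have "(x, y) \<in> L \<longleftrightarrow> (h x, h y) \<in> omega_plus_omega_star" for x y
  proof -
    \<comment> \<open>Only finitely many numbers lie above \<open>y\<close>, hence infinitely many
      below it. If \<open>y\<close> were below \<open>x\<close>, then infinitely many would lie
      below \<open>x\<close>.\<close>
    have cross: "(x, y) \<in> L \<and> (y, x) \<notin> L" if "x \<in> A" "y \<notin> A" for x y
    proof -
      have "(y, x) \<notin> L"
      proof
        assume yx: "(y, x) \<in> L"
        have "infinite {z. (z, y) \<in> L}"
        proof
          assume "finite {z. (z, y) \<in> L}"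
          then have "finite ({z. (z, y) \<in> L} \<union> {z. (y, z) \<in> L} \<union> {y})"
            using fin(2)[OF that(2)] by simp
          moreover have "{z. (z, y) \<in> L} \<union> {z. (y, z) \<in> L} \<union> {y} = UNIV"
            using tot by (auto simp: total_on_def)
          ultimately show False using infinite_UNIV_nat by metis
        qed
        moreover have "{z. (z, y) \<in> L} \<subseteq> {z. (z, x) \<in> L}" using yx tr by (auto dest: transD)
        ultimately show False using fin(1)[OF that(1)] finite_subset by blast
      qed
      moreover have "x \<noteq> y" using that by auto
      ultimately show ?thesis using tot by (auto simp: total_on_def)
    qed
    show ?thesis
      using f(2)[of x y] g(2)[of y x] cross[of x y] cross[of y x]
      by (auto simp: h_def omega_plus_omega_star_def order_sum_def)
  qed
  ultimately show ?thesis unfolding order_isomorphic_def by blast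
qed

section \<open>Transitive patterns as permutations\<close>

lemma transitive_patternD:
  assumes "transitive_pattern l p" "a < b" "b < c" "c < l" "p a b = p b c"
  shows "p a c = p a b"
proof (rule ccontr)
  assume "p a c \<noteq> p a b"
  define g where "g = (\<lambda>i::nat. if i = 0 then a else if i = 1 then b else c)"
  have "strict_mono_on {..<3} g" "g ` {..<3} \<subseteq> {..<l}"
    using assms by (auto simp: strict_mono_on_def g_def)
  moreover have "p (g i) (g j) = nontransitive3 (p a b) i j" if "i < j" "j < 3" for i j
  proof -
    have "i = 0 \<and> j = 1 \<or> i = 0 \<and> j = 2 \<or> i = 1 \<and> j = 2" using that by linarith
    then show ?thesis using assms \<open>p a c \<noteq> p a b\<close> by (auto simp: nontransitive3_def g_def)
  qed
  ultimately have "contains_pattern l p 3 (nontransitive3 (p a b))"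
    unfolding contains_pattern_def by blast
  then show False using assms(1) by (auto simp: transitive_pattern_def)
qed

text \<open>\<open>R\<close> orders the indices as the pattern prescribes, and the value of an index
  is the number of its predecessors.\<close>

lemma transitive_pattern_values:
  assumes "transitive_pattern l p"
  shows "\<exists>v :: nat \<Rightarrow> nat. \<forall>i j. i < j \<and> j < l \<longrightarrow> (if p i j then v j < v i else v i < v j)"
proof -
  define R where "R = (\<lambda>i j. i < j \<and> \<not> p i j \<or> j < i \<and> p j i)"
  have irr: "\<not> R i i" for i by (simp add: R_def)
  \<comment> \<open>For each relative position of the three indices, a failure would contradict
    \<open>transitive_patternD\<close>; \<open>i = k\<close> is impossible.\<close>
  have tr: "R i k" if "R i j" "R j k" "i < l" "j < l" "k < l" for i j k
    using that transitive_patternD[OF assms] unfolding R_def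
    by (smt (verit, ccfv_threshold) linorder_neqE_nat order_less_trans order_less_asym)
  define v where "v = (\<lambda>i. card {k. k < l \<and> R k i})"
  have mono: "v i < v j" if "R i j" "i < l" "j < l" for i j
  proof -
    have "{k. k < l \<and> R k i} \<subseteq> {k. k < l \<and> R k j}" using tr that by blast
    moreover have "i \<in> {k. k < l \<and> R k j}" "i \<notin> {k. k < l \<and> R k i}" using irr that by auto
    ultimately have "{k. k < l \<and> R k i} \<subset> {k. k < l \<and> R k j}" by blast
    then show ?thesis unfolding v_def by (intro psubset_card_mono) auto
  qed
  have "if p i j then v j < v i else v i < v j" if "i < j" "j < l" for i j
    using mono[of i j] mono[of j i] that by (auto simp: R_def)
  then show ?thesis by blast
qed

section \<open>The finite injury construction\<close>

text \<open>\<open>S r a b\<close> says that by stage \<open>b\<close> requirement \<open>r\<close>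
  accepts the block that began at \<open>a\<close>; there are \<open>len r\<close> blocks, with
  values \<open>val r\<close>. By \<open>S_gt\<close> requirement \<open>r\<close> is idle up to
  stage \<open>r\<close>; by \<open>S_mono\<close> a success is permanent.\<close>

locale block_construction =
  fixes S :: "nat \<Rightarrow> nat \<Rightarrow> nat \<Rightarrow> bool" and len :: "nat \<Rightarrow> nat" and val :: "nat \<Rightarrow> nat \<Rightarrow> nat"
  assumes S_gt: "S r a b \<Longrightarrow> r < b"
    and S_mono: "S r a b \<Longrightarrow> b \<le> b' \<Longrightarrow> S r a b'"
begin

text \<open>At stage \<open>s\<close>, the run of requirement \<open>r\<close> that began at stage \<open>t\<close> is in its block
  \<open>fst (run r t s)\<close>, which began at stage \<open>snd (run r t s)\<close>. Requirement \<open>r\<close> starts a new run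
  whenever a requirement of higher priority (that is, a smaller one) passes to its next block.\<close>

primrec run :: "nat \<Rightarrow> nat \<Rightarrow> nat \<Rightarrow> nat \<times> nat" where
  "run r t 0 = (0, t)"
| "run r t (Suc s) =
     (if t \<le> s \<and> fst (run r t s) < len r \<and> S r (snd (run r t s)) (Suc s)
      then (Suc (fst (run r t s)), Suc s) else run r t s)"

text \<open>No history of injuries is stored: \<open>start r s\<close> is the stage of the last
  block change among the requirements below \<open>r\<close> (0 if there was none), and the run of
  \<open>r\<close> is recomputed from there.\<close>

primrec start :: "nat \<Rightarrow> nat \<Rightarrow> nat" where
  "start 0 s = 0"
| "start (Suc r) s = snd (run r (start r s) s)"

definition idx :: "nat \<Rightarrow> nat \<Rightarrow> nat" where
  "idx r s = fst (run r (start r s) s)"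

definition key :: "nat \<Rightarrow> nat \<Rightarrow> nat" where
  "key s r = val r (idx r s)"

definition L :: "(nat \<times> nat) set" where
  "L = {(x, y). less_fun (key x) (key y) \<or> key x = key y \<and> x < y}"

section \<open>Restarts and stabilization\<close>

lemma run_le: "s \<le> t \<Longrightarrow> run r t s = (0, t)"
  by (induction s) auto

lemma snd_run_ge: "t \<le> snd (run r t s)"
  by (induction s) auto

lemma snd_run_le: "t \<le> s \<Longrightarrow> snd (run r t s) \<le> s"
proof (induction s)
  case (Suc s)
  then show ?case by (cases "t = Suc s") (auto simp: run_le)
qed simp

text \<open>The current block began at \<open>snd (run r t s)\<close>, and nothing has changed
  since.\<close>

lemma run_eq: "snd (run r t s) \<le> x \<Longrightarrow> x \<le> s \<Longrightarrow> run r t x = run r t s"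
proof (induction s)
  case (Suc s)
  then show ?case by (cases "x = Suc s") (auto split: if_splits)
qed simp

lemma fst_run_le_len: "fst (run r t s) \<le> len r"
  by (induction s) auto

lemma fst_run_mono: "s \<le> s' \<Longrightarrow> fst (run r t s) \<le> fst (run r t s')"
  by (rule lift_Suc_mono_le) auto

text \<open>By \<open>S_gt\<close> the first block is not left before stage \<open>Suc r\<close>.
  Hence the keys of two numbers can differ in only finitely many coordinates.\<close>

lemma idx_eq_0: "s \<le> r \<Longrightarrow> idx r s = 0"
proof -
  have "s \<le> r \<Longrightarrow> fst (run r t s) = 0" for t
  proof (induction s)
    case (Suc s)
    then show ?case using S_gt[of r _ "Suc s"] by fastforce
  qed simp
  then show "s \<le> r \<Longrightarrow> idx r s = 0" by (simp add: idx_def)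
qed

lemma start_mono: "r \<le> r' \<Longrightarrow> start r s \<le> start r' s"
  by (rule lift_Suc_mono_le[of "\<lambda>r. start r s"]) (auto simp: snd_run_ge)

lemma start_eq: "start r s \<le> x \<Longrightarrow> x \<le> s \<Longrightarrow> start r x = start r s"
proof (induction r)
  case (Suc r)
  then have "start r x = start r s" using start_mono[of r "Suc r" s] by simp
  then show ?case using Suc.prems run_eq by simp
qed simp

text \<open>A later block change of \<open>r\<close> would have moved \<open>start r' s\<close>
  beyond \<open>x\<close>.\<close>

lemma idx_eq: "r < r' \<Longrightarrow> start r' s \<le> x \<Longrightarrow> x \<le> s \<Longrightarrow> idx r x = idx r s"
proof -
  assume *: "r < r'" "start r' s \<le> x" "x \<le> s"
  then have "start (Suc r) s \<le> x" using start_mono[of "Suc r" r' s] by simp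
  then show ?thesis
    using * start_eq[of r s x] start_mono[of r "Suc r" s] run_eq by (simp add: idx_def)
qed

lemma run_stabilizes: "\<exists>s0. \<forall>s\<ge>s0. run r t s = run r t s0"
proof -
  have "\<exists>s0. True \<and> (\<forall>s. True \<longrightarrow> fst (run r t s) \<le> fst (run r t s0))"
    using fst_run_le_len by (intro ex_has_greatest_nat[of "\<lambda>_. True" 0 _ "Suc (len r)"]) (auto simp: less_Suc_eq_le)
  then obtain s0 where s0: "\<And>s. fst (run r t s) \<le> fst (run r t s0)" by blast
  have "run r t s = run r t s0" if "s0 \<le> s" for s
    using that
  proof (induction rule: dec_induct)
    case (step n)
    have "fst (run r t (Suc n)) \<le> fst (run r t n)" unfolding step.IH by (rule s0)
    then have "run r t (Suc n) = run r t n" by (auto split: if_splits)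
    then show ?case using step.IH by (rule trans)
  qed simp
  then show ?thesis by blast
qed

text \<open>Finite injury: once \<open>r\<close> is restarted no more, its run changes blocks at
  most \<open>len r\<close> times, and then \<open>Suc r\<close> is restarted no more.\<close>

lemma start_stabilizes: "\<exists>s0. \<forall>s\<ge>s0. start r s = start r s0"
proof (induction r)
  case (Suc r)
  then obtain s0 where s0: "\<And>s. s \<ge> s0 \<Longrightarrow> start r s = start r s0" by blast
  obtain s1 where s1: "\<And>s. s \<ge> s1 \<Longrightarrow> run r (start r s0) s = run r (start r s0) s1"
    using run_stabilizes by blast
  have "start (Suc r) s = start (Suc r) (max s0 s1)" if "max s0 s1 \<le> s" for s
    using that s0[of s] s0[of "max s0 s1"] s1[of s] s1[of "max s0 s1"] by simp
  then show ?case by blast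
qed simp

definition stage :: "nat \<Rightarrow> nat" where
  "stage r = (SOME s0. \<forall>s\<ge>s0. start r s = start r s0 \<and> run r (start r s) s = run r (start r s0) s0)"

definition final_start :: "nat \<Rightarrow> nat" where "final_start r = start r (stage r)"
definition final_idx :: "nat \<Rightarrow> nat" where "final_idx r = idx r (stage r)"
definition final_key :: "nat \<Rightarrow> nat" where "final_key r = val r (final_idx r)"

lemma stage:
  assumes "stage r \<le> s"
  shows "start r s = final_start r" "run r (final_start r) s = run r (final_start r) (stage r)"
    "idx r s = final_idx r"
proof -
  obtain s0 where s0: "\<And>s. s \<ge> s0 \<Longrightarrow> start r s = start r s0" using start_stabilizes by blast
  obtain s1 where s1: "\<And>s. s \<ge> s1 \<Longrightarrow> run r (start r s0) s = run r (start r s0) s1"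
    using run_stabilizes by blast
  have "\<exists>s2. \<forall>s\<ge>s2. start r s = start r s2 \<and> run r (start r s) s = run r (start r s2) s2"
  proof (intro exI[of _ "max s0 s1"] allI impI)
    fix s assume "s \<ge> max s0 s1"
    then show "start r s = start r (max s0 s1) \<and>
        run r (start r s) s = run r (start r (max s0 s1)) (max s0 s1)"
      using s0[of s] s0[of "max s0 s1"] s1[of s] s1[of "max s0 s1"] by simp
  qed
  then have *: "\<forall>s\<ge>stage r. start r s = start r (stage r) \<and>
      run r (start r s) s = run r (start r (stage r)) (stage r)"
    unfolding stage_def by (rule someI_ex)
  have st: "start r s = start r (stage r)" and rn: "run r (start r s) s = run r (start r (stage r)) (stage r)"
    using * assms by blast+
  show "start r s = final_start r" unfolding final_start_def by (rule st)
  show "run r (final_start r) s = run r (final_start r) (stage r)"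
    unfolding final_start_def using rn unfolding st .
  show "idx r s = final_idx r"
    unfolding idx_def final_idx_def rn by (rule refl)
qed

text \<open>The bound is the last restart, not the possibly later \<open>stage r\<close>: seen from
  a late stage \<open>s\<close>, nothing relevant has changed since that restart.\<close>

lemma after_final_start:
  assumes "final_start r \<le> x"
  shows "start r x = final_start r" "r' < r \<Longrightarrow> idx r' x = final_idx r'"
proof -
  define s where "s = x + stage r + stage r'"
  have s: "start r s = final_start r" "idx r' s = final_idx r'" "x \<le> s"
    using stage(1)[of r s] stage(3)[of r' s] by (simp_all add: s_def)
  show "start r x = final_start r"
    using start_eq[of r s x] s assms by simp
  show "r' < r \<Longrightarrow> idx r' x = final_idx r'"
    using idx_eq[of r' r s x] s assms by simp
qed

text \<open>If the last run stopped early, the search from its current block would succeed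
  eventually and the run would move on.\<close>

lemma final_idx:
  assumes "\<And>a. \<exists>b. S r a b"
  shows "final_idx r = len r"
proof (rule ccontr)
  let ?t = "final_start r"
  define s where "s = ?t + stage r"
  have "run r ?t s = run r ?t (stage r)" "idx r s = final_idx r" "start r s = ?t"
    using stage[of r s] by (simp_all add: s_def)
  assume "final_idx r \<noteq> len r"
  then have less: "fst (run r ?t (stage r)) < len r"
    using \<open>idx r s = final_idx r\<close> \<open>start r s = ?t\<close> fst_run_le_len[of r ?t s]
      \<open>run r ?t s = run r ?t (stage r)\<close>
    by (simp add: idx_def)
  obtain b where b: "S r (snd (run r ?t (stage r))) b" using assms by blast
  \<comment> \<open>Late enough that the run has settled and the search has succeeded; stage
    \<open>Suc u\<close> would change it.\<close>
  define u where "u = s + b"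
  have "stage r \<le> u" "?t \<le> u" by (simp_all add: u_def s_def)
  then have "run r ?t u = run r ?t (stage r)" "run r ?t (Suc u) = run r ?t (stage r)"
    using stage(2)[of r u] stage(2)[of r "Suc u"] by simp_all
  moreover have "S r (snd (run r ?t (stage r))) (Suc u)"
    using b by (rule S_mono) (simp add: u_def)
  ultimately have "(Suc (fst (run r ?t (stage r))), Suc u) = run r ?t (stage r)"
    using less \<open>?t \<le> u\<close> by simp
  then show False by (metis fst_conv n_not_Suc_n)
qed

lemma run_block:
  "i < fst (run r t s) \<Longrightarrow> \<exists>a b. t \<le> a \<and> a < b \<and> S r a b \<and> (\<forall>x. a \<le> x \<and> x < b \<longrightarrow> fst (run r t x) = i)"
proof (induction s)
  case (Suc s)
  show ?case
  proof (cases "i < fst (run r t s)")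
    case True
    then show ?thesis by (rule Suc.IH)
  next
    case False
    then have act: "t \<le> s" "S r (snd (run r t s)) (Suc s)" "fst (run r t s) = i"
      using Suc.prems by (auto split: if_splits)
    have "fst (run r t x) = i" if "snd (run r t s) \<le> x" "x < Suc s" for x
      using run_eq[of r t s x] that act(3) by simp
    moreover have "snd (run r t s) < Suc s" using snd_run_le[OF act(1)] by (simp add: less_Suc_eq_le)
    ultimately show ?thesis using act snd_run_ge by blast
  qed
qed simp

text \<open>The completed blocks of the last run. All requirements of higher priority have settled
  there, so keys of numbers from different blocks agree below coordinate \<open>r\<close>.\<close>

lemma blocks:
  assumes "\<And>a. \<exists>b. S r a b"
  shows "\<exists>A B. \<forall>i<len r. A i < B i \<and> S r (A i) (B i) \<and>
    (\<forall>x. A i \<le> x \<and> x < B i \<longrightarrow> final_start r \<le> x \<and> idx r x = i \<and> (\<forall>r'<r. idx r' x = final_idx r'))"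
proof -
  let ?t = "final_start r"
  have len: "fst (run r ?t (stage r)) = len r"
    using final_idx[OF assms] by (simp add: final_idx_def idx_def final_start_def)
  have "\<exists>a b. a < b \<and> S r a b \<and> (\<forall>x. a \<le> x \<and> x < b \<longrightarrow>
      ?t \<le> x \<and> idx r x = i \<and> (\<forall>r'<r. idx r' x = final_idx r'))" if "i < len r" for i
  proof -
    have "\<exists>a b. ?t \<le> a \<and> a < b \<and> S r a b \<and> (\<forall>x. a \<le> x \<and> x < b \<longrightarrow> fst (run r ?t x) = i)"
      using len that by (intro run_block[of i r ?t "stage r"]) simp
    then obtain a b where ab: "?t \<le> a" "a < b" "S r a b"
      "\<And>x. a \<le> x \<Longrightarrow> x < b \<Longrightarrow> fst (run r ?t x) = i"
      by blast
    have "?t \<le> x \<and> idx r x = i \<and> (\<forall>r'<r. idx r' x = final_idx r')" if "a \<le> x" "x < b" for x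
    proof -
      have "?t \<le> x" using ab(1) that(1) by simp
      then show ?thesis
        using after_final_start ab(4)[OF that] by (auto simp: idx_def[of r])
    qed
    then show ?thesis using ab by blast
  qed
  then show ?thesis by metis
qed

lemma less_if_idx_less:
  assumes "final_start r \<le> x" "final_start r \<le> y" "idx r x < idx r y"
  shows "x < y"
proof (rule ccontr)
  assume "\<not> x < y"
  then have "idx r y \<le> idx r x"
    using fst_run_mono[of y x r "final_start r"] after_final_start(1) assms(1,2)
    by (simp add: idx_def)
  then show False using assms(3) by simp
qed

section \<open>The order \<open>L\<close> and its order type\<close>

lemma strict_linear_order_L: "strict_linear_order L"
  unfolding strict_linear_order_on_def
proof (intro conjI)
  show "trans L"
    unfolding L_def trans_def by (auto intro: less_fun_trans)
  show "irrefl L"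
    unfolding L_def irrefl_def by (auto simp: less_fun_irrefl)
  show "total L"
    unfolding total_on_def
  proof (intro ballI impI)
    fix x y :: nat
    assume "x \<noteq> y"
    show "(x, y) \<in> L \<or> (y, x) \<in> L"
    proof (cases "key x = key y")
      case True
      then show ?thesis using \<open>x \<noteq> y\<close> by (auto simp: L_def)
    next
      case False
      then have ex: "\<exists>r. key x r \<noteq> key y r" by auto
      define r where "r = (LEAST r. key x r \<noteq> key y r)"
      have "key x r \<noteq> key y r" "\<And>r'. r' < r \<Longrightarrow> key x r' = key y r'"
        using LeastI_ex[OF ex] not_less_Least[of _ "\<lambda>r. key x r \<noteq> key y r"] unfolding r_def by blast+
      then have "less_fun (key x) (key y) \<or> less_fun (key y) (key x)"
        unfolding less_fun_def by (metis linorder_neqE_nat)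
      then show ?thesis by (auto simp: L_def)
    qed
  qed
qed

text \<open>Keys converge coordinatewise to \<open>final_key\<close>. A number whose key is below
  this limit is below almost all numbers, and one whose key is above it is above almost all. The two
  families of one-block requirements keep every key different from the limit and make both kinds
  infinite.\<close>

lemma order_isomorphic_L:
  assumes inf: "infinite {r. len r = 1 \<and> val r 0 < val r 1 \<and> (\<forall>a. \<exists>b. S r a b)}"
      "infinite {r. len r = 1 \<and> val r 1 < val r 0 \<and> (\<forall>a. \<exists>b. S r a b)}"
    (is "infinite ?D")
  shows "order_isomorphic L omega_plus_omega_star"
proof -
  let ?U = "{r. len r = 1 \<and> val r 0 < val r 1 \<and> (\<forall>a. \<exists>b. S r a b)}"
  have fkey: "final_key r = val r 1" if "r \<in> ?U \<union> ?D" for r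
    using final_idx[of r] that by (auto simp: final_key_def)
  define d where "d = (\<lambda>x. LEAST r. key x r \<noteq> final_key r)"
  have d: "key x (d x) \<noteq> final_key (d x)" and d_less: "r < d x \<Longrightarrow> key x r = final_key r" for x r
  proof -
    \<comment> \<open>At stage \<open>x\<close> this requirement is still in block 0, but it ends
      with index 1, where the value is different.\<close>
    obtain r where r: "r \<in> ?U" "x \<le> r"
      using inf(1) by (meson infinite_nat_iff_unbounded_le)
    then have "key x r \<noteq> final_key r"
      using fkey[of r] idx_eq_0[of x r] by (auto simp: key_def)
    then have ex: "\<exists>r. key x r \<noteq> final_key r" by blast
    show "key x (d x) \<noteq> final_key (d x)" unfolding d_def using ex by (rule LeastI_ex)
  next
    show "r < d x \<Longrightarrow> key x r = final_key r" unfolding d_def using not_less_Least by blast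
  qed
  define A where "A = {x. key x (d x) < final_key (d x)}"
  \<comment> \<open>Only the coordinates up to \<open>d x\<close> matter, and finitely many
    coordinates settle together.\<close>
  have late: "\<exists>n. \<forall>y>n. (\<forall>r\<le>d x. key y r = final_key r)" for x
  proof (intro exI allI impI)
    fix y r assume "(\<Sum>r\<le>d x. stage r) < y" "r \<le> d x"
    moreover have "stage r \<le> (\<Sum>r\<le>d x. stage r)"
      using \<open>r \<le> d x\<close> by (intro member_le_sum) auto
    ultimately show "key y r = final_key r" using stage(3)[of r y] by (simp add: key_def final_key_def)
  qed
  have lt: "less_fun (key x) (key y)"
    if "x \<in> A" "\<forall>r\<le>d x. key y r = final_key r" for x y
    unfolding less_fun_def using that d_less[of _ x] by (intro exI[of _ "d x"]) (auto simp: A_def)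
  have gt: "less_fun (key y) (key x)"
    if "x \<notin> A" "\<forall>r\<le>d x. key y r = final_key r" for x y
    unfolding less_fun_def using that d_less[of _ x] d[of x] by (intro exI[of _ "d x"]) (auto simp: A_def)
  have asym: "(x, y) \<in> L \<Longrightarrow> (y, x) \<notin> L" for x y
    using strict_linear_order_L unfolding strict_linear_order_on_def irrefl_def by (meson transD)
  \<comment> \<open>At its last restart \<open>r\<close> is in block 0 while all smaller
    requirements have settled, so the key of this number first leaves the limit at
    \<open>r\<close>.\<close>
  have x_r: "d (final_start r) = r" "key (final_start r) r = val r 0" if "r \<in> ?U \<union> ?D" for r
  proof -
    show *: "key (final_start r) r = val r 0"
      using after_final_start(1)[of r "final_start r"] by (simp add: key_def idx_def run_le)
    show "d (final_start r) = r"
      unfolding d_def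
    proof (rule Least_equality)
      show "key (final_start r) r \<noteq> final_key r" using * fkey that by auto
      fix r' assume "key (final_start r) r' \<noteq> final_key r'"
      then show "r \<le> r'"
        using after_final_start(2)[of r "final_start r" r'] by (force simp: key_def final_key_def)
    qed
  qed
  show ?thesis
  proof (rule order_isomorphic_omega_plus_omega_star[OF strict_linear_order_L, of A])
    fix x assume "x \<in> A"
    obtain n where n: "\<And>y. y > n \<Longrightarrow> \<forall>r\<le>d x. key y r = final_key r" using late by blast
    have no: "(y, x) \<notin> L" if "y > n" for y
      using lt[OF \<open>x \<in> A\<close> n[OF that]] asym[of x y] by (simp add: L_def)
    have "{y. (y, x) \<in> L} \<subseteq> {..n}"
    proof (rule subsetI, rule ccontr)
      fix y assume "y \<in> {y. (y, x) \<in> L}" "y \<notin> {..n}"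
      then show False using no[of y] by simp
    qed
    then show "finite {y. (y, x) \<in> L}" by (rule finite_subset) simp
  next
    fix x assume "x \<notin> A"
    obtain n where n: "\<And>y. y > n \<Longrightarrow> \<forall>r\<le>d x. key y r = final_key r" using late by blast
    have no: "(x, y) \<notin> L" if "y > n" for y
      using gt[OF \<open>x \<notin> A\<close> n[OF that]] asym[of y x] by (simp add: L_def)
    have "{y. (x, y) \<in> L} \<subseteq> {..n}"
    proof (rule subsetI, rule ccontr)
      fix y assume "y \<in> {y. (x, y) \<in> L}" "y \<notin> {..n}"
      then show False using no[of y] by simp
    qed
    then show "finite {y. (x, y) \<in> L}" by (rule finite_subset) simp
  next
    have "inj_on final_start ?U" using x_r(1) by (metis (no_types, lifting) UnI1 inj_onI)
    then have "infinite (final_start ` ?U)" using inf(1) by (simp add: finite_image_iff)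
    moreover have "final_start ` ?U \<subseteq> A" using x_r fkey by (auto simp: A_def)
    ultimately show "infinite A" using finite_subset by blast
  next
    have "inj_on final_start ?D" using x_r(1) by (metis (no_types, lifting) UnI2 inj_onI)
    then have "infinite (final_start ` ?D)" using inf(2) by (simp add: finite_image_iff)
    moreover have "final_start ` ?D \<subseteq> - A" using x_r fkey by (auto simp: A_def)
    ultimately show "infinite (- A)" using finite_subset by blast
  qed
qed

lemma L_blocks:
  assumes "\<And>r'. r' < r \<Longrightarrow> idx r' x = idx r' y" "val r (idx r x) < val r (idx r y)"
  shows "(x, y) \<in> L"
  unfolding L_def less_fun_def using assms by (auto simp: key_def)

end

section \<open>Coin tossing measure\<close>

definition coin_measure :: "(nat \<Rightarrow> bool) measure" where
  "coin_measure = PiM UNIV (\<lambda>_. measure_pmf (bernoulli_pmf (1 / 2)))"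

lemma prob_space_coin_measure: "prob_space coin_measure"
  unfolding coin_measure_def by (intro prob_space_PiM measure_pmf.prob_space_axioms)

interpretation coin: prob_space coin_measure
  by (rule prob_space_coin_measure)

lemma space_coin_measure [simp]: "space coin_measure = UNIV"
  by (simp add: coin_measure_def space_PiM)

definition cylinder :: "nat \<Rightarrow> nat \<Rightarrow> (nat \<Rightarrow> bool) set" where
  "cylinder b \<sigma> = {X. \<forall>i<b. X i = bit \<sigma> i}"

lemma sets_cylinder: "cylinder b \<sigma> \<in> sets coin_measure"
proof -
  have "{X. X i = c} \<in> sets coin_measure" for i c
    using measurable_sets[OF measurable_component_singleton[of i UNIV
          "\<lambda>_. measure_pmf (bernoulli_pmf (1 / 2))"], of "{c}"]
    by (simp add: coin_measure_def space_PiM vimage_def)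
  then have "{X \<in> space coin_measure. \<forall>i\<in>{..<b}. X i = bit \<sigma> i} \<in> sets coin_measure"
    by (intro sets.sets_Collect_finite_All) auto
  then show ?thesis by (simp add: cylinder_def Ball_def)
qed

lemma measure_cylinder: "measure coin_measure (cylinder b \<sigma>) = (1 / 2) ^ b"
proof -
  interpret product_prob_space "\<lambda>_. measure_pmf (bernoulli_pmf (1 / 2))" UNIV
    by unfold_locales
  have "emeasure coin_measure {X \<in> space coin_measure. \<forall>i\<in>{..<b}. X i \<in> {bit \<sigma> i}} =
      (\<Prod>i<b. emeasure (measure_pmf (bernoulli_pmf (1 / 2))) {bit \<sigma> i})"
    unfolding coin_measure_def by (rule emeasure_PiM_Collect) auto
  also have "\<dots> = (\<Prod>i<b. ennreal (1 / 2))"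
  proof (rule prod.cong)
    fix i
    show "emeasure (measure_pmf (bernoulli_pmf (1 / 2))) {bit \<sigma> i} = ennreal (1 / 2)"
      by (cases "bit \<sigma> i") (simp_all add: emeasure_pmf_single)
  qed simp
  also have "\<dots> = ennreal ((1 / 2) ^ b)"
    unfolding prod_constant card_lessThan by (rule ennreal_power) simp
  finally show ?thesis by (simp add: cylinder_def measure_def Ball_def)
qed

text \<open>An event decided by the first \<open>b\<close> digits is a disjoint union of cylinders,
  so its measure is found by counting binary strings.\<close>

lemma
  assumes cong: "\<And>X Y. (\<And>i. i < b \<Longrightarrow> X i = Y i) \<Longrightarrow> P X = P Y"
  shows sets_finite_use: "{X. P X} \<in> sets coin_measure"
    and measure_finite_use:
      "measure coin_measure {X. P X} = real (\<Sum>\<sigma><2 ^ b :: nat. of_bool (P (bit \<sigma>))) / 2 ^ b"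
proof -
  define T where "T = {\<sigma> \<in> {..<2 ^ b :: nat}. P (bit \<sigma>)}"
  have eq: "{X. P X} = (\<Union>\<sigma>\<in>T. cylinder b \<sigma>)"
  proof (intro equalityI subsetI)
    fix X assume "X \<in> {X. P X}"
    define \<sigma> :: nat where "\<sigma> = take_bit b (horner_sum of_bool 2 (map X [0..<b]))"
    have bits: "X i = bit \<sigma> i" if "i < b" for i
      using that by (simp add: \<sigma>_def bit_take_bit_iff bit_horner_sum_bit_iff)
    moreover have "P (bit \<sigma>)" using cong[of X "bit \<sigma>", OF bits] \<open>X \<in> _\<close> by simp
    moreover have "\<sigma> < 2 ^ b" by (simp add: \<sigma>_def)
    ultimately show "X \<in> (\<Union>\<sigma>\<in>T. cylinder b \<sigma>)" by (auto simp: T_def cylinder_def)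
  next
    fix X assume "X \<in> (\<Union>\<sigma>\<in>T. cylinder b \<sigma>)"
    then obtain \<sigma> :: nat where "P (bit \<sigma>)" "\<forall>i<b. X i = bit \<sigma> i"
      by (auto simp: T_def cylinder_def)
    then show "X \<in> {X. P X}" using cong[of X "bit \<sigma>"] by simp
  qed
  show "{X. P X} \<in> sets coin_measure"
    unfolding eq by (intro sets.finite_UN) (auto simp: T_def sets_cylinder)
  have "disjoint_family_on (cylinder b) T"
    unfolding disjoint_family_on_def
  proof (intro ballI impI, rule ccontr)
    fix \<sigma> \<tau> assume *: "\<sigma> \<in> T" "\<tau> \<in> T" "\<sigma> \<noteq> \<tau>" "cylinder b \<sigma> \<inter> cylinder b \<tau> \<noteq> {}"
    then have "bit \<sigma> i = bit \<tau> i" if "i < b" for i using that by (auto simp: cylinder_def)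
    then have "take_bit b \<sigma> = take_bit b \<tau>" by (auto simp: bit_eq_iff bit_take_bit_iff)
    then show False using * by (simp add: T_def take_bit_nat_eq_self)
  qed
  then have "measure coin_measure {X. P X} = (\<Sum>\<sigma>\<in>T. measure coin_measure (cylinder b \<sigma>))"
    unfolding eq by (intro coin.finite_measure_finite_Union) (auto simp: T_def sets_cylinder)
  also have "\<dots> = real (card T) / 2 ^ b"
    by (simp add: measure_cylinder power_one_over)
  also have "card T = (\<Sum>\<sigma><2 ^ b :: nat. of_bool (P (bit \<sigma>)))"
    by (simp add: T_def sum_of_bool_eq Int_def conj_commute)
  finally show "measure coin_measure {X. P X} = real (\<Sum>\<sigma><2 ^ b :: nat. of_bool (P (bit \<sigma>))) / 2 ^ b" .
qed

text \<open>The covers for \<open>1 / Suc n\<close> intersect in a measurable null set, and the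
  completion contains all its subsets.\<close>

lemma null_sets_cantor_measureI:
  assumes "\<And>\<epsilon>. \<epsilon> > 0 \<Longrightarrow> \<exists>N\<in>sets coin_measure. E \<subseteq> N \<and> measure coin_measure N \<le> \<epsilon>"
  shows "E \<in> null_sets cantor_measure"
proof -
  obtain N where N: "\<And>n :: nat. N n \<in> sets coin_measure" "\<And>n. E \<subseteq> N n"
    "\<And>n. measure coin_measure (N n) \<le> 1 / real (Suc n)"
    using assms[of "1 / real (Suc _)"] by (metis of_nat_0_less_iff zero_less_Suc zero_less_divide_1_iff)
  define M where "M = (\<Inter>n. N n)"
  have M: "M \<in> sets coin_measure" unfolding M_def using N(1) by (intro sets.countable_INT) auto
  have "measure coin_measure M \<le> 1 / real (Suc n)" for n
  proof -
    have "measure coin_measure M \<le> measure coin_measure (N n)"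
      using N(1) by (intro coin.finite_measure_mono) (auto simp: M_def)
    then show ?thesis using N(3)[of n] by linarith
  qed
  then have "measure coin_measure M \<le> 0"
    by (intro LIMSEQ_le_const[OF LIMSEQ_inverse_real_of_nat]) (auto simp: inverse_eq_divide)
  then have "emeasure coin_measure M = 0"
    by (simp add: coin.emeasure_eq_measure measure_le_0_iff)
  then have "M \<in> null_sets coin_measure" using M by (simp add: null_sets_def)
  moreover have "E \<subseteq> M" using N(2) by (auto simp: M_def)
  ultimately show ?thesis
    unfolding cantor_measure_def coin_measure_def[symmetric]
    using null_sets_completionI null_sets_completion_subset by blast
qed

section \<open>The requirements\<close>

context block_construction begin

text \<open>From coordinate \<open>x + y\<close> on, both numbers are in block 0 of every
  requirement, so their keys agree.\<close>

lemma L_iff_bounded: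
  "(x, y) \<in> L \<longleftrightarrow>
     (\<exists>r<x + y. key x r < key y r \<and> (\<forall>r'<r. key x r' = key y r')) \<or>
     (\<forall>r<x + y. key x r = key y r) \<and> x < y"
proof -
  have "key x r = key y r" if "x + y \<le> r" for r
    using that idx_eq_0[of x r] idx_eq_0[of y r] by (simp add: key_def)
  then have "key x = key y \<longleftrightarrow> (\<forall>r<x + y. key x r = key y r)"
      "\<And>r. key x r < key y r \<Longrightarrow> r < x + y"
    by (auto simp: fun_eq_iff) (metis not_le, metis less_irrefl not_le)
  then show ?thesis unfolding L_def less_fun_def by auto
qed

lemma decidable_L:
  assumes S: "decidable (\<lambda>v. S (v 0) (v (Suc 0)) (v (Suc (Suc 0))))"
    and len: "recfn (\<lambda>v. len (v 0))" and val: "recfn (\<lambda>v. val (v 0) (v (Suc 0)))"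
  shows "decidable (\<lambda>v. (v 0, v (Suc 0)) \<in> L)"
proof -
  \<comment> \<open>The state of a run is coded as one number, to fit primitive recursion with a
    single accumulated value.\<close>
  have run_eq: "prod_encode (run r t s) = rec_nat (prod_encode (0, t)) (\<lambda>s z.
      if t \<le> s \<and> pfst z < len r \<and> S r (psnd z) (Suc s) then prod_encode (Suc (pfst z), Suc s) else z) s"
    for r t s
  proof (induction s)
    case (Suc s)
    show ?case
      by (cases "run r t s") (simp flip: Suc.IH)
  qed simp
  have run: "recfn (\<lambda>v. prod_encode (run (f v) (g v) (h v)))"
    if "recfn f" "recfn g" "recfn h" for f g h
  proof (rule recfn_comp3[OF _ that])
    show "recfn (\<lambda>v. prod_encode (run (v 0) (v (Suc 0)) (v (Suc (Suc 0)))))"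
      unfolding run_eq
      by (intro recfn_rec recfn_intros recfn_code_intros decidable_subst3[OF S] recfn_comp1[OF len])
  qed
  have start_eq: "start r s = rec_nat 0 (\<lambda>r t. psnd (prod_encode (run r t s))) r" for r s
    by (induction r) (simp_all add: psnd_def)
  have start: "recfn (\<lambda>v. start (v 0) (v (Suc 0)))"
    unfolding start_eq by (intro recfn_rec recfn_intros recfn_code_intros run)
  have key_eq: "key s r = val r (pfst (prod_encode (run r (start r s) s)))" for r s
    by (simp add: key_def idx_def pfst_def)
  have key: "recfn (\<lambda>v. key (f v) (g v))" if "recfn f" "recfn g" for f g
  proof (rule recfn_comp2[OF _ that])
    show "recfn (\<lambda>v. key (v 0) (v (Suc 0)))"
      unfolding key_eq
      by (intro recfn_comp2[OF val] recfn_comp2[OF start] recfn_intros recfn_code_intros run)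
  qed
  show ?thesis
    unfolding L_iff_bounded by (intro recfn_intros key)
qed

end

text \<open>A requirement codes a program, a threshold \<open>num / den\<close> for the measure, a lower bound for
  the elements that count, and the values of its blocks. The last value belongs to the numbers
  after the blocks, so there is one block less than there are values.\<close>

definition prog_of :: "nat \<Rightarrow> nat" where "prog_of r = pfst r"
definition num_of :: "nat \<Rightarrow> nat" where "num_of r = pfst (pfst (psnd r))"
definition den_of :: "nat \<Rightarrow> nat" where "den_of r = psnd (pfst (psnd r))"
definition origin_of :: "nat \<Rightarrow> nat" where "origin_of r = pfst (psnd (psnd r))"
definition length_of :: "nat \<Rightarrow> nat" where "length_of r = hdc (psnd (psnd (psnd r)))"
text \<open>The number of blocks is stored in front of the values, hence
  \<open>Suc i\<close>.\<close>

definition value_of :: "nat \<Rightarrow> nat \<Rightarrow> nat" where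
  "value_of r i = hdc (dropc (Suc i) (psnd (psnd (psnd r))))"

definition requirement :: "nat \<Rightarrow> nat \<Rightarrow> nat \<Rightarrow> nat \<Rightarrow> nat list \<Rightarrow> nat" where
  "requirement c num den m vs = prod_encode (c, prod_encode (prod_encode (num, den),
     prod_encode (m, list_encode ((length vs - 1) # vs))))"

lemma requirement_simps [simp]:
  "prog_of (requirement c num den m vs) = c"
  "num_of (requirement c num den m vs) = num"
  "den_of (requirement c num den m vs) = den"
  "origin_of (requirement c num den m vs) = m"
  "length_of (requirement c num den m vs) = length vs - 1"
  by (simp_all add: requirement_def prog_of_def num_of_def den_of_def origin_of_def length_of_def
      del: list_encode.simps)

lemma value_of_requirement [simp]:
  "i < length vs \<Longrightarrow> value_of (requirement c num den m vs) i = vs ! i"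
  using hdc_list_encode_drop[of "Suc i" "(length vs - 1) # vs"]
  by (simp add: requirement_def value_of_def del: dropc.simps list_encode.simps)

text \<open>The threshold inequality with denominators cleared, where the measure is a count of
  strings of length \<open>b\<close>. The conditional is a maximum, and \<open>r < b\<close>
  provides \<open>S_gt\<close>.\<close>

definition requirement_met :: "nat \<Rightarrow> nat \<Rightarrow> nat \<Rightarrow> bool" where
  "requirement_met r a b \<longleftrightarrow> r < b \<and> num_of r * 2 ^ b \<le> den_of r *
     (\<Sum>\<sigma><2 ^ b :: nat. of_bool (hits (bit \<sigma>) (prog_of r) (if a \<le> origin_of r then origin_of r else a) b))"

lemma sets_hits: "{X. hits X c a b} \<in> sets coin_measure"
  by (rule sets_finite_use[of b]) (rule hits_cong)

lemma requirement_met_iff: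
  "requirement_met r a b \<longleftrightarrow> r < b \<and>
     real (num_of r) \<le> real (den_of r) * measure coin_measure {X. hits X (prog_of r) (max a (origin_of r)) b}"
proof -
  let ?n = "\<Sum>\<sigma><2 ^ b :: nat. of_bool (hits (bit \<sigma>) (prog_of r) (max a (origin_of r)) b) :: nat"
  have m: "measure coin_measure {X. hits X (prog_of r) (max a (origin_of r)) b} = real ?n / 2 ^ b"
    by (rule measure_finite_use) (rule hits_cong)
  have "num_of r * 2 ^ b \<le> den_of r * ?n \<longleftrightarrow> real (num_of r * 2 ^ b) \<le> real (den_of r * ?n)"
    by (rule of_nat_le_iff[symmetric])
  also have "\<dots> \<longleftrightarrow> real (num_of r) \<le> real (den_of r) * (real ?n / 2 ^ b)"
    unfolding of_nat_mult of_nat_power by (simp add: field_simps)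
  finally have "num_of r * 2 ^ b \<le> den_of r * ?n \<longleftrightarrow>
      real (num_of r) \<le> real (den_of r) * (real ?n / 2 ^ b)" .
  then show ?thesis unfolding requirement_met_def m max_def[symmetric] by (simp only:)
qed

interpretation block_construction requirement_met length_of value_of
proof
  show "requirement_met r a b \<Longrightarrow> r < b" for r a b by (simp add: requirement_met_def)
next
  fix r a b b' assume s: "requirement_met r a b" and le: "b \<le> b'"
  have "measure coin_measure {X. hits X (prog_of r) (max a (origin_of r)) b} \<le>
      measure coin_measure {X. hits X (prog_of r) (max a (origin_of r)) b'}"
    using le by (intro coin.finite_measure_mono sets_hits) (auto intro: hits_mono)
  then have "real (den_of r) * measure coin_measure {X. hits X (prog_of r) (max a (origin_of r)) b} \<le>
      real (den_of r) * measure coin_measure {X. hits X (prog_of r) (max a (origin_of r)) b'}"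
    by (intro mult_left_mono) auto
  then show "requirement_met r a b'" using s le unfolding requirement_met_iff by linarith
qed

lemma computable_rel_L: "computable_rel L"
proof (intro computable_rel_if_decidable decidable_L)
  have "decidable (\<lambda>v. requirement_met (v 0) (v (Suc 0)) (v (Suc (Suc 0))))"
    unfolding requirement_met_def num_of_def den_of_def prog_of_def origin_of_def
    by (intro recfn_intros recfn_code_intros decidable_hits)
  then show "decidable (\<lambda>v. requirement_met (v 0) (v (Suc 0)) (v (Suc (Suc 0))))" .
  show "recfn (\<lambda>v. length_of (v 0))"
    unfolding length_of_def by (intro recfn_intros recfn_code_intros)
  show "recfn (\<lambda>v. value_of (v 0) (v (Suc 0)))"
    unfolding value_of_def by (intro recfn_intros recfn_code_intros)
qed

lemma order_isomorphic_L_omega: "order_isomorphic L omega_plus_omega_star"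
proof (rule order_isomorphic_L)
  \<comment> \<open>The threshold inequality \<open>0 \<le> 0\<close> always holds, so each search
    ends as soon as \<open>b\<close> exceeds the requirement; varying the origin \<open>m\<close>
    gives infinitely many requirements.\<close>
  define R where "R = (\<lambda>vs m. requirement 0 0 0 m vs)"
  have inj: "inj (R vs)" for vs
    by (rule inj_on_inverseI[of _ origin_of]) (simp add: R_def)
  have sat: "\<exists>b. requirement_met (R vs m) a b" for vs m a
    by (intro exI[of _ "Suc (R vs m)"]) (simp add: requirement_met_iff R_def)
  have "range (R [0, 1]) \<subseteq> {r. length_of r = 1 \<and> value_of r 0 < value_of r 1 \<and> (\<forall>a. \<exists>b. requirement_met r a b)}"
    using sat by (auto simp: R_def)
  then show "infinite {r. length_of r = 1 \<and> value_of r 0 < value_of r 1 \<and> (\<forall>a. \<exists>b. requirement_met r a b)}"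
    using inj range_inj_infinite infinite_super by blast
  have "range (R [1, 0]) \<subseteq> {r. length_of r = 1 \<and> value_of r 1 < value_of r 0 \<and> (\<forall>a. \<exists>b. requirement_met r a b)}"
    using sat by (auto simp: R_def)
  then show "infinite {r. length_of r = 1 \<and> value_of r 1 < value_of r 0 \<and> (\<forall>a. \<exists>b. requirement_met r a b)}"
    using inj range_inj_infinite infinite_super by blast
qed

section \<open>Oracles that compute an infinite avoiding set\<close>

definition avoiding :: "nat \<Rightarrow> nat list \<Rightarrow> (nat \<Rightarrow> bool) set" where
  "avoiding c vs = {X. \<exists>e H. prog_encode e = c \<and> infinite H \<and>
     (\<forall>n. evaluates X e [n] (of_bool (n \<in> H))) \<and> avoids L (length vs) (\<lambda>i j. vs ! j < vs ! i) H}"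

definition hits_beyond :: "nat \<Rightarrow> nat \<Rightarrow> (nat \<Rightarrow> bool) set" where
  "hits_beyond c a = (\<Union>b. {X. hits X c a b})"

lemma sets_hits_beyond: "hits_beyond c a \<in> sets coin_measure"
  unfolding hits_beyond_def by (intro sets.countable_UN) (auto simp: sets_hits)

lemma avoiding_subset_hits_beyond: "avoiding c vs \<subseteq> hits_beyond c a"
proof
  fix X assume "X \<in> avoiding c vs"
  then obtain e H where e: "prog_encode e = c" "infinite H"
    "\<And>n. evaluates X e [n] (of_bool (n \<in> H))"
    unfolding avoiding_def by blast
  obtain x where "a \<le> x" "x \<in> H" using e(2) by (meson infinite_nat_iff_unbounded_le)
  then have "evaluates X e [x] 1" using e(3)[of x] by simp
  then obtain b where "hits X c a b" using evaluates_imp_hits[OF _ \<open>a \<le> x\<close>] e(1) by blast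
  then show "X \<in> hits_beyond c a" by (auto simp: hits_beyond_def)
qed

lemma measure_hits_tendsto:
  "(\<lambda>b. measure coin_measure {X. hits X c a b}) \<longlonglongrightarrow> measure coin_measure (hits_beyond c a)"
  unfolding hits_beyond_def
  by (rule coin.finite_Lim_measure_incseq) (auto simp: sets_hits incseq_def intro: hits_mono)

lemma measure_hits_beyond_tendsto:
  "(\<lambda>a. measure coin_measure (hits_beyond c a)) \<longlonglongrightarrow>
     measure coin_measure (\<Inter>a. hits_beyond c a)"
  by (rule coin.finite_Lim_measure_decseq)
    (auto simp: decseq_def intro: sets_hits_beyond, auto simp: hits_beyond_def intro: hits_mono)

lemma realizes_if_hits_blocks:
  assumes mono: "\<And>i j. i < j \<Longrightarrow> j < l \<Longrightarrow> x i < x j"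
    and L: "\<And>i j. i < l \<Longrightarrow> j < l \<Longrightarrow> v i < v j \<Longrightarrow> (x i, x j) \<in> L"
    and v: "\<And>i j. i < j \<Longrightarrow> j < l \<Longrightarrow> v i \<noteq> (v j :: nat)"
  shows "realizes L l (\<lambda>i j. v j < v i) (x ` {..<l})"
proof -
  have sm: "strict_mono_on {..<l} x" using mono by (simp add: strict_mono_on_def)
  have inj: "inj_on x {..<l}" by (rule strict_mono_on_imp_inj_on[OF sm])
  have "sorted_wrt (<) (map x [0..<l])"
    using mono by (simp add: sorted_wrt_iff_nth_less)
  then have "sorted_list_of_set (set (map x [0..<l])) = map x [0..<l]"
    by (intro sorted_list_of_set.idem_if_sorted_distinct) (auto simp: strict_sorted_iff)
  then have enum: "sorted_list_of_set (x ` {..<l}) = map x [0..<l]"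
    by (simp add: lessThan_atLeast0)
  have "order_coloring L (x i) (x j) = (v j < v i)" if "i < j" "j < l" for i j
  proof -
    have "(x j, x i) \<in> L \<Longrightarrow> (x i, x j) \<notin> L"
      using strict_linear_order_L unfolding strict_linear_order_on_def irrefl_def by (meson transD)
    moreover have "i < l" using that by simp
    ultimately show ?thesis
      using L[of i j] L[of j i] v[OF that] that linorder_neqE_nat[of "v i" "v j"]
      unfolding order_coloring_def by (auto dest: less_asym)
  qed
  then show ?thesis unfolding realizes_def enum using inj by (simp add: card_image)
qed

text \<open>A denominator above \<open>1 / \<delta>\<close>, and as numerator the largest integer
  strictly below \<open>g * den\<close>, which is nonnegative because \<open>g\<close> is
  positive.\<close>

lemma ex_threshold:
  assumes "0 < (g :: real)" "0 < \<delta>"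
  shows "\<exists>num den :: nat. 0 < den \<and> real num < g * real den \<and> (g - \<delta>) * real den \<le> real num"
proof -
  obtain den :: nat where den: "1 / \<delta> < real den" using reals_Archimedean2 by blast
  then have pos: "0 < real den" using assms(2) by (smt (verit) zero_less_divide_1_iff)
  have "1 < \<delta> * real den" using den assms(2) by (simp add: field_simps)
  moreover have "0 < g * real den" using pos assms(1) by simp
  then have "1 \<le> \<lceil>g * real den\<rceil>" by simp
  then have "real (nat (\<lceil>g * real den\<rceil> - 1)) = of_int \<lceil>g * real den\<rceil> - 1" by simp
  ultimately show ?thesis
    using pos by (intro exI[of _ "nat (\<lceil>g * real den\<rceil> - 1)"] exI[of _ den])
      (simp add: algebra_simps, linarith)
qed

text \<open>An oracle in \<open>avoiding c vs\<close> must miss one of the \<open>l\<close> blocks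
  of a suitable requirement, since otherwise its set would realize the pattern. Each block is missed
  by little of \<open>hits_beyond c m\<close>.\<close>

lemma avoiding_small:
  assumes v: "\<And>i j. i < j \<Longrightarrow> j < length vs \<Longrightarrow> vs ! i \<noteq> vs ! j" and "0 < \<epsilon>"
  shows "\<exists>N\<in>sets coin_measure. avoiding c vs \<subseteq> N \<and> measure coin_measure N \<le> \<epsilon>"
proof (cases "measure coin_measure (\<Inter>a. hits_beyond c a) = 0")
  case True
  have "(\<Inter>a. hits_beyond c a) \<in> sets coin_measure"
    by (intro sets.countable_INT) (auto simp: sets_hits_beyond)
  then show ?thesis
    using True assms(2) avoiding_subset_hits_beyond by (intro bexI[of _ "\<Inter>a. hits_beyond c a"]) auto
next
  case False
  define l where "l = length vs"
  define g where "g = measure coin_measure (\<Inter>a. hits_beyond c a)"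
  \<comment> \<open>Each block loses at most \<open>2 * \<delta>\<close>; \<open>Suc l\<close> keeps
    the denominator positive when \<open>l = 0\<close>.\<close>
  define \<delta> where "\<delta> = \<epsilon> / (2 * real (Suc l))"
  have "0 < g" "0 < \<delta>" using False assms(2) by (simp_all add: g_def \<delta>_def zero_less_measure_iff)
  then obtain num den :: nat where
    nd: "0 < den" "real num < g * real den" "(g - \<delta>) * real den \<le> real num"
    using ex_threshold by blast
  have "eventually (\<lambda>a. measure coin_measure (hits_beyond c a) < g + \<delta>) sequentially"
    using measure_hits_beyond_tendsto[of c] \<open>0 < \<delta>\<close> by (intro order_tendstoD) (auto simp: g_def)
  then obtain m where m: "measure coin_measure (hits_beyond c m) < g + \<delta>"
    by (auto simp: eventually_sequentially)
  \<comment> \<open>The appended 0 is the value for the numbers after the last block, so the entries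
    of \<open>vs\<close> belong exactly to the \<open>l\<close> blocks.\<close>
  define r where "r = requirement c num den m (vs @ [0])"
  have total: "\<exists>b. requirement_met r a b" for a
  proof -
    let ?a = "max a m"
    \<comment> \<open>Every search succeeds because \<open>num / den\<close> is strictly below
      \<open>g\<close>, while the measures of the hits increase to at least
      \<open>g\<close>.\<close>
    have "g \<le> measure coin_measure (hits_beyond c ?a)"
      unfolding g_def by (intro coin.finite_measure_mono sets_hits_beyond) auto
    then have "real num < measure coin_measure (hits_beyond c ?a) * real den"
      using nd(1,2) by (smt (verit) mult_right_mono of_nat_0_le_iff)
    then have "real num / real den < measure coin_measure (hits_beyond c ?a)"
      using nd(1) by (simp add: field_simps)
    then have "eventually (\<lambda>b. real num / real den < measure coin_measure {X. hits X c ?a b}) sequentially"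
      by (intro order_tendstoD(1)[OF measure_hits_tendsto])
    then have "eventually (\<lambda>b. r < b \<and> real num / real den < measure coin_measure {X. hits X c ?a b}) sequentially"
      using eventually_gt_at_top[of r] by (rule eventually_conj[rotated])
    then obtain b where "r < b" "real num / real den < measure coin_measure {X. hits X c ?a b}"
      by (auto simp: eventually_sequentially)
    then show ?thesis
      using nd(1) by (intro exI[of _ b]) (simp add: requirement_met_iff r_def field_simps)
  qed
  have len: "length_of r = l" by (simp add: r_def l_def)
  have val: "value_of r i = vs ! i" if "i < l" for i
    using that value_of_requirement[of i "vs @ [0]" c num den m] by (simp add: r_def l_def nth_append)
  obtain A B where AB: "\<And>i. i < l \<Longrightarrow> requirement_met r (A i) (B i)"
    "\<And>i x. i < l \<Longrightarrow> A i \<le> x \<Longrightarrow> x < B i \<Longrightarrow> final_start r \<le> x \<and> idx r x = i \<and>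
       (\<forall>r'<r. idx r' x = final_idx r')"
    using blocks[OF total] len by metis
  define W where "W = (\<lambda>i. {X. hits X c (max (A i) m) (B i)})"
  define N where "N = (\<Union>i<l. hits_beyond c m - W i)"
  have W: "W i \<in> sets coin_measure" "W i \<subseteq> hits_beyond c m" for i
    using sets_hits[of c] hits_mono[of _ c "max (A i) m" "B i" "B i" m]
    by (auto simp: W_def hits_beyond_def)
  \<comment> \<open>\<open>W i\<close> has measure at least \<open>g - \<delta>\<close> and lies in
    \<open>hits_beyond c m\<close>, whose measure is below \<open>g + \<delta>\<close>.\<close>
  have small: "measure coin_measure (hits_beyond c m - W i) \<le> 2 * \<delta>" if "i < l" for i
  proof -
    have "real num \<le> real den * measure coin_measure (W i)"
      using AB(1)[OF that] by (simp add: requirement_met_iff r_def W_def)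
    then have "(g - \<delta>) * real den \<le> measure coin_measure (W i) * real den"
      using nd(3) by (simp add: mult.commute)
    then have "g - \<delta> \<le> measure coin_measure (W i)" using nd(1) by simp
    moreover have "measure coin_measure (hits_beyond c m - W i) =
        measure coin_measure (hits_beyond c m) - measure coin_measure (W i)"
      by (intro coin.finite_measure_Diff sets_hits_beyond W)
    ultimately show ?thesis using m by linarith
  qed
  have "measure coin_measure N \<le> (\<Sum>i<l. measure coin_measure (hits_beyond c m - W i))"
    unfolding N_def using W sets_hits_beyond by (intro measure_UNION_le) auto
  also have "\<dots> \<le> (\<Sum>i<l. 2 * \<delta>)" using small by (intro sum_mono) auto
  also have "\<dots> \<le> \<epsilon>" using assms(2) by (simp add: \<delta>_def field_simps)
  finally have "measure coin_measure N \<le> \<epsilon>" .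
  moreover have "N \<in> sets coin_measure"
    unfolding N_def using W sets_hits_beyond by (intro sets.finite_UN) auto
  moreover have "avoiding c vs \<subseteq> N"
  proof (rule subsetI, rule ccontr)
    fix X assume X: "X \<in> avoiding c vs" "X \<notin> N"
    then have hitW: "X \<in> W i" if "i < l" for i
      using that avoiding_subset_hits_beyond by (auto simp: N_def)
    obtain e H where e: "prog_encode e = c"
      "\<And>n. evaluates X e [n] (of_bool (n \<in> H))" "avoids L l (\<lambda>i j. vs ! j < vs ! i) H"
      using X(1) unfolding avoiding_def l_def by blast
    have "\<exists>x. A i \<le> x \<and> x < B i \<and> x \<in> H" if i: "i < l" for i
    proof -
      obtain x where x: "max (A i) m \<le> x" "x < B i" "evaluates X e [x] 1"
        using hitW[OF i] hits_imp_evaluates unfolding W_def e(1)[symmetric] by blast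
      have "of_bool (x \<in> H) = (1 :: nat)" by (rule evaluates_deterministic[OF x(3) e(2)])
      then have "x \<in> H" by (cases "x \<in> H") auto
      then show ?thesis using x by auto
    qed
    then obtain x where x: "\<And>i. i < l \<Longrightarrow> A i \<le> x i \<and> x i < B i \<and> x i \<in> H" by metis
    have xr: "final_start r \<le> x i" "idx r (x i) = i" "\<And>r'. r' < r \<Longrightarrow> idx r' (x i) = final_idx r'"
      if "i < l" for i
      using AB(2)[OF that, of "x i"] x[OF that] by auto
    have "realizes L l (\<lambda>i j. vs ! j < vs ! i) (x ` {..<l})"
    proof (rule realizes_if_hits_blocks[where v = "(!) vs"])
      fix i j assume ij: "i < j" "j < l"
      then have i: "i < l" by simp
      show "x i < x j"
        using less_if_idx_less[of r "x i" "x j"] xr(1,2)[OF i] xr(1,2)[OF ij(2)] ij(1) by simp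
    next
      fix i j assume i: "i < l" and j: "j < l" and less: "vs ! i < vs ! j"
      show "(x i, x j) \<in> L"
      proof (rule L_blocks[of r])
        show "idx r' (x i) = idx r' (x j)" if "r' < r" for r'
          using xr(3)[OF i that] xr(3)[OF j that] by simp
        show "value_of r (idx r (x i)) < value_of r (idx r (x j))"
          unfolding xr(2)[OF i] xr(2)[OF j] val[OF i] val[OF j] by (rule less)
      qed
    next
      show "vs ! i \<noteq> vs ! j" if "i < j" "j < l" for i j
        using v that by (simp add: l_def)
    qed
    moreover have "x ` {..<l} \<subseteq> H" using x by auto
    ultimately show False using e(3) by (auto simp: avoids_def)
  qed
  ultimately show ?thesis by blast
qed

lemma avoids_cong:
  assumes "\<And>i j. i < j \<Longrightarrow> j < l \<Longrightarrow> p i j = q i j"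
  shows "avoids L l p H = avoids L l q H"
  using assms unfolding avoids_def realizes_def by simp

theorem theorem7p7:
  "\<exists>L :: (nat \<times> nat) set.
     strict_linear_order L \<and>
     computable_rel L \<and>
     order_isomorphic L omega_plus_omega_star \<and>
     {X :: nat \<Rightarrow> bool.
        \<exists>H. infinite H \<and> computes_set X H \<and>
          (\<exists>l p. transitive_pattern l p \<and> avoids L l p H)} \<in> null_sets cantor_measure"
proof (intro exI[of _ L] conjI strict_linear_order_L computable_rel_L order_isomorphic_L_omega)
  \<comment> \<open>Lists of distinct values represent the permutations. There are countably many of
    them and countably many program codes, so a countable union of null sets covers the
    class.\<close>
  define V :: "nat list set" where "V = {vs. \<forall>i j. i < j \<and> j < length vs \<longrightarrow> vs ! i \<noteq> vs ! j}"
  have "avoiding c vs \<in> null_sets cantor_measure" if "vs \<in> V" for c vs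
    using that by (intro null_sets_cantor_measureI avoiding_small) (auto simp: V_def)
  then have null: "(\<Union>c. \<Union>vs\<in>V. avoiding c vs) \<in> null_sets cantor_measure"
    by (intro null_sets_UN null_sets_UN') auto
  have "{X. \<exists>H. infinite H \<and> computes_set X H \<and>
          (\<exists>l p. transitive_pattern l p \<and> avoids L l p H)} \<subseteq> (\<Union>c. \<Union>vs\<in>V. avoiding c vs)"
  proof clarify
    fix X H l p
    assume H: "infinite H" "computes_set X H" "transitive_pattern l p" "avoids L l p H"
    obtain e where e: "\<And>n. evaluates X e [n] (of_bool (n \<in> H))"
      using H(2) unfolding computes_set_def by blast
    obtain v :: "nat \<Rightarrow> nat" where
      v: "\<And>i j. i < j \<Longrightarrow> j < l \<Longrightarrow> if p i j then v j < v i else v i < v j"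
      using transitive_pattern_values[OF H(3)] by blast
    define vs where "vs = map v [0..<l]"
    have "avoids L l (\<lambda>i j. vs ! j < vs ! i) H = avoids L l p H"
      using v by (intro avoids_cong) (force simp: vs_def split: if_splits)
    then have "X \<in> avoiding (prog_encode e) vs"
      unfolding avoiding_def using H(1,4) e
      by (intro CollectI exI[of _ e] exI[of _ H]) (simp add: vs_def del: of_bool_eq_iff)
    moreover have "vs \<in> V"
      using v by (fastforce simp: V_def vs_def split: if_splits)
    ultimately show "X \<in> (\<Union>c. \<Union>vs\<in>V. avoiding c vs)" by blast
  qed
  then show "{X. \<exists>H. infinite H \<and> computes_set X H \<and>
      (\<exists>l p. transitive_pattern l p \<and> avoids L l p H)} \<in> null_sets cantor_measure"
    using null unfolding cantor_measure_def by (rule null_sets_completion_subset)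
qed

end
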